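(* Let $G^A$ be a simple connected signable pseudo-invertible graph of order $m\ge 2$ with adjacency matrix $A$. Then: i) $\Lambda^{gap}(G^A)\le 2\sqrt{\lfloor m/2\rfloor\lceil m/2\rceil}$ and $\Lambda^{ind}(G^A)\le \sqrt{\lfloor m/2\rfloor\lceil m/2\rceil}$. The equalities are attained by the complete bipartite graph $K_{m_1,m_2}$ where $m_1=\lceil m/2\rceil$, $m_2=\lfloor m/2\rfloor$. ii) $\Lambda^{pow}(G^A)\ge 2\sqrt{m-1}$. The equality is attained by the complete bipartite star graph $K_{m-1,1}\equiv S_m$.
   Context: For a real symmetric matrix $A$, $A^\dagger$ denotes its Moore-Penrose inverse. $A^\dagger$ is called positively (negatively) signable if there exists a diagonal matrix $D$ with diagonal entries in $\{+1,-1\}$ such that all entries of $DA^\dagger D$ are non-negative (non-positive). A graph $G^A$ with adjacency matrix $A$ is called signable pseudo-invertible if $A^\dagger$ is positively signable or negatively signable. For a simple connected graph with adjacency matrix $A$ and eigenvalues $\lambda_1,\dots,\lambda_m$ (counted with multiplicity), let $\lambda_+(A)$ be the least positive eigenvalue and $\lambda_-(A)$ the largest negative eigenvalue of $A$. The spectral indices are $\Lambda^{gap}(G^A)=\Lambda^{gap}(A)=\lambda_+(A)-\lambda_-(A)$, $\Lambda^{ind}(G^A)=\Lambda^{ind}(A)=\max(|\lambda_+(A)|,|\lambda_-(A)|)$, and $\Lambda^{pow}(G^A)=\Lambda^{pow}(A)=\sum_{k=1}^m|\lambda_k|$. *)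

theory Defs
  imports
    "Jordan_Normal_Form.Char_Poly"
    "Graph_Theory.Kuratowski"
begin

text \<open>
  Simple graphs are the symmetric, loop-free digraphs without parallel arcs of
  \<^locale>\<open>graph\<close>. An adjacency matrix depends on an enumeration of the vertices, so a graph
  has one adjacency matrix for each of them.
\<close>

definition is_adjacency_matrix :: "real mat \<Rightarrow> ('a, 'b) pre_digraph \<Rightarrow> bool" where
  "is_adjacency_matrix A G \<longleftrightarrow>
     (\<exists>vs. distinct vs \<and> set vs = verts G \<and>
        A = mat (length vs) (length vs)
              (\<lambda>(i, j). if (vs ! i, vs ! j) \<in> arcs_ends G then 1 else 0))"

definition is_moore_penrose_inverse :: "real mat \<Rightarrow> real mat \<Rightarrow> bool" where
  "is_moore_penrose_inverse A X \<longleftrightarrow>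
     X \<in> carrier_mat (dim_col A) (dim_row A) \<and>
     A * X * A = A \<and>
     X * A * X = X \<and>
     transpose_mat (A * X) = A * X \<and>
     transpose_mat (X * A) = X * A"

definition pseudo_inverse :: "real mat \<Rightarrow> real mat" where
  "pseudo_inverse A = (THE X. is_moore_penrose_inverse A X)"

definition is_signature_matrix :: "nat \<Rightarrow> real mat \<Rightarrow> bool" where
  "is_signature_matrix n D \<longleftrightarrow>
     D \<in> carrier_mat n n \<and> diagonal_mat D \<and> (\<forall>i<n. D $$ (i, i) \<in> {1, -1})"

definition positively_signable :: "real mat \<Rightarrow> bool" where
  "positively_signable B \<longleftrightarrow>
     (\<exists>D. is_signature_matrix (dim_row B) D \<and>
        (\<forall>i<dim_row B. \<forall>j<dim_col B. (D * B * D) $$ (i, j) \<ge> 0))"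

definition negatively_signable :: "real mat \<Rightarrow> bool" where
  "negatively_signable B \<longleftrightarrow>
     (\<exists>D. is_signature_matrix (dim_row B) D \<and>
        (\<forall>i<dim_row B. \<forall>j<dim_col B. (D * B * D) $$ (i, j) \<le> 0))"

definition signable_pseudo_invertible :: "real mat \<Rightarrow> bool" where
  "signable_pseudo_invertible A \<longleftrightarrow>
     positively_signable (pseudo_inverse A) \<or> negatively_signable (pseudo_inverse A)"

text \<open>
  The next two are meaningful only if \<open>A\<close> has positive and negative eigenvalues, as is the case
  for the adjacency matrix of a graph with at least one edge.
\<close>

definition least_pos_eigenvalue :: "real mat \<Rightarrow> real" where
  "least_pos_eigenvalue A = Min {x. eigenvalue A x \<and> x > 0}"

definition greatest_neg_eigenvalue :: "real mat \<Rightarrow> real" where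
  "greatest_neg_eigenvalue A = Max {x. eigenvalue A x \<and> x < 0}"

definition spectral_gap :: "real mat \<Rightarrow> real" where
  "spectral_gap A = least_pos_eigenvalue A - greatest_neg_eigenvalue A"

definition spectral_ind :: "real mat \<Rightarrow> real" where
  "spectral_ind A = max \<bar>least_pos_eigenvalue A\<bar> \<bar>greatest_neg_eigenvalue A\<bar>"

text \<open>
  The multiplicity of an eigenvalue is its order as a root of the characteristic polynomial;
  a real symmetric matrix has only real eigenvalues, so none are missed here.
\<close>

definition spectral_pow :: "real mat \<Rightarrow> real" where
  "spectral_pow A =
     (\<Sum>x | eigenvalue A x. of_nat (Polynomial.order x (char_poly A)) * \<bar>x\<bar>)"

text \<open>The pseudo-inverse is well defined whenever it exists.\<close>

lemma is_moore_penrose_inverse_unique: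
  assumes X: "is_moore_penrose_inverse A X" and Y: "is_moore_penrose_inverse A Y"
  shows "X = Y"
proof -
  define m n where "m = dim_row A" and "n = dim_col A"
  have A: "A \<in> carrier_mat m n" by (auto simp: m_def n_def)
  have XC: "X \<in> carrier_mat n m" and YC: "Y \<in> carrier_mat n m"
    using X Y by (auto simp: is_moore_penrose_inverse_def m_def n_def)
  note c = A XC YC mult_carrier_mat[OF A XC] mult_carrier_mat[OF A YC]
    mult_carrier_mat[OF XC A] mult_carrier_mat[OF YC A]
  note X = X[unfolded is_moore_penrose_inverse_def] and Y = Y[unfolded is_moore_penrose_inverse_def]
  have 1: "A * X = A * Y"
  proof -
    have "A * X = transpose_mat ((A * Y) * (A * X))"
    proof -
      have "(A * Y) * (A * X) = (A * Y * A) * X"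
        using assoc_mult_mat[OF c(5) A XC] by simp
      then show ?thesis using X Y by simp
    qed
    also have "\<dots> = (A * X) * (A * Y)"
      using transpose_mult[OF c(5) c(4)] X Y by simp
    also have "\<dots> = (A * X * A) * Y"
      using assoc_mult_mat[OF c(4) A YC] by simp
    finally show ?thesis using X by simp
  qed
  have 2: "X * A = Y * A"
  proof -
    have "X * A = transpose_mat ((X * A) * (Y * A))"
    proof -
      have "(X * A) * (Y * A) = X * (A * (Y * A))"
        using assoc_mult_mat[OF XC A c(7)] by simp
      also have "A * (Y * A) = A * Y * A"
        using assoc_mult_mat[OF A YC A] by simp
      finally show ?thesis using X Y by simp
    qed
    also have "\<dots> = (Y * A) * (X * A)"
      using transpose_mult[OF c(6) c(7)] X Y by simp
    also have "\<dots> = Y * (A * (X * A))"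
      using assoc_mult_mat[OF YC A c(6)] by simp
    also have "A * (X * A) = A * X * A"
      using assoc_mult_mat[OF A XC A] by simp
    finally show ?thesis using X by simp
  qed
  have "X = X * A * X" using X by simp
  also have "\<dots> = Y * A * X" by (simp add: 2)
  also have "\<dots> = Y * (A * Y)" using assoc_mult_mat[OF YC A XC] 1 by simp
  also have "\<dots> = Y * A * Y" using assoc_mult_mat[OF YC A YC] by simp
  also have "\<dots> = Y" using Y by simp
  finally show ?thesis .
qed

end

theory Submission
  imports
    Defs
    "Jordan_Normal_Form.Schur_Decomposition"
    "Jordan_Normal_Form.Spectral_Radius"
    "HOL-Analysis.Convex"
begin

text \<open>
  Write $\beta = \sqrt{\lfloor m/2 \rfloor \lceil m/2 \rceil}$, let $\lambda_1, \dots, \lambda_m$ be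
  the eigenvalues of the adjacency matrix $A$, and let $J$ be the all-ones matrix.

  The bounds on the gap and the index follow from $\lambda_+ \le \beta$ and $\lambda_- \ge -\beta$.
  By Constantine's argument (\<open>quadratic_form_ge\<close>) the quadratic form of any matrix with entries in
  $[0,1]$ is at least $-\beta \|x\|^2$, so no eigenvalue lies below $-\beta$. This applies to $J - A$
  as well. If $A$ has at least two positive eigenvalues, there is a nonzero vector $x$ that is
  orthogonal to the all-ones vector and satisfies
  $\lambda_+ \|x\|^2 \le x^T A x = - x^T (J - A) x \le \beta \|x\|^2$; this gives $\lambda_+ \le \beta$.
  Signability is used in the remaining case of a single positive eigenvalue. Then non-adjacency is
  transitive (\<open>missing_transitivity_imp_two_positive_eigenvalues\<close>), that is, the graph is complete
  multipartite. Its pseudo-inverse is known explicitly (\<open>multipartite_moore_penrose\<close>), and its sign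
  pattern rules out three or more parts (\<open>three_parts_not_signable\<close>). So the graph is complete
  bipartite with parts of sizes $p + q = m$, and $\lambda_+ = \sqrt{p q} \le \beta$.

  For the power, $\sum_k \lambda_k = 0$ implies $(\sum_k |\lambda_k|)^2 \ge 2 \sum_k \lambda_k^2$
  (\<open>spectral_pow_ge\<close>). The sum of squares is the number of arcs, which is twice the number of edges,
  and a connected graph has at least $m - 1$ edges.

  The nonzero eigenvalues of the complete bipartite graph with parts of sizes $p$ and $q$ are
  $\pm\sqrt{p q}$ (\<open>complete_bipartite_eigenvalues\<close>), and its pseudo-inverse has no negative entries.
  Balanced parts attain the bounds on gap and index, and the star attains the bound on the power.
\<close>

section \<open>The real spectral theorem\<close>

text \<open>
  Over the complex numbers some eigenvalue $z$ with eigenvector $v$ exists. Evaluating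
  $\bar v^T A v$ in two ways shows that $z = \bar z$, so $z$ is a real root of the characteristic
  polynomial, which is the same over both fields.
\<close>

lemma symmetric_real_eigenvalue_exists:
  fixes A :: "real mat"
  assumes A: "A \<in> carrier_mat n n" and sym: "transpose_mat A = A" and n: "n \<noteq> 0"
  obtains e where "eigenvalue A e"
proof -
  let ?C = "map_mat complex_of_real A"
  have C: "?C \<in> carrier_mat n n" using A by simp
  obtain z where "eigenvalue ?C z"
    using spectrum_non_empty[OF C] n by (auto simp: spectrum_def)
  then obtain v where v: "v \<in> carrier_vec n" "v \<noteq> 0\<^sub>v n" and ev: "?C *\<^sub>v v = z \<cdot>\<^sub>v v"
    using C by (auto simp: eigenvalue_def eigenvector_def)
  have comp: "(\<Sum>j<n. complex_of_real (A $$ (i,j)) * v $ j) = z * v $ i" if "i < n" for i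
    using arg_cong[OF ev, of "\<lambda>w. w $ i"] that A v
    by (auto simp: scalar_prod_def lessThan_atLeast0)
  have symA: "A $$ (i,j) = A $$ (j,i)" if "i < n" "j < n" for i j
    using arg_cong[OF sym, of "\<lambda>M. M $$ (i,j)"] that A by simp
  define N where "N = (\<Sum>i<n. v $ i * cnj (v $ i))"
  have "z * N = (\<Sum>i<n. (\<Sum>j<n. of_real (A $$ (i,j)) * v $ j) * cnj (v $ i))"
    unfolding N_def sum_distrib_left by (intro sum.cong refl) (simp add: comp mult.assoc)
  also have "\<dots> = (\<Sum>i<n. \<Sum>j<n. v $ j * (of_real (A $$ (j,i)) * cnj (v $ i)))"
    unfolding sum_distrib_right by (intro sum.cong refl) (simp add: symA)
  also have "\<dots> = (\<Sum>j<n. \<Sum>i<n. v $ j * (of_real (A $$ (j,i)) * cnj (v $ i)))"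
    by (rule sum.swap)
  also have "\<dots> = (\<Sum>j<n. v $ j * cnj (\<Sum>i<n. of_real (A $$ (j,i)) * v $ i))"
    by (simp add: sum_distrib_left)
  also have "\<dots> = cnj z * N"
    unfolding N_def sum_distrib_left by (intro sum.cong refl) (simp add: comp)
  finally have zN: "z * N = cnj z * N" .
  have "N = v \<bullet>c v" using v by (simp add: N_def scalar_prod_def lessThan_atLeast0)
  then have "N \<noteq> 0" using conjugate_square_eq_0_vec[OF v(1)] v(2) by simp
  with zN have "z = cnj z" by simp
  then obtain e where e: "z = complex_of_real e"
    by (metis Reals_cases Reals_cnj_iff)
  have "poly (char_poly ?C) z = 0"
    using \<open>eigenvalue ?C z\<close> eigenvalue_root_char_poly[OF C] by simp
  then have "poly (char_poly A) e = 0"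
    unfolding e of_real_hom.char_poly_hom[OF A] by simp
  then show thesis using eigenvalue_root_char_poly[OF A] that by blast
qed

text \<open>
  Gram-Schmidt applied to a basis that starts with $v$ keeps the direction of its first vector;
  it yields orthogonal vectors that still have to be normalised.
\<close>

lemma orthogonal_mat_with_first_column:
  fixes v :: "real vec"
  assumes v: "v \<in> carrier_vec n" "v \<noteq> 0\<^sub>v n"
  obtains W c where "W \<in> carrier_mat n n" "transpose_mat W * W = 1\<^sub>m n" "col W 0 = c \<cdot>\<^sub>v v"
proof -
  interpret cof_vec_space n "TYPE(real)" .
  define ws where "ws = gram_schmidt n (basis_completion v)"
  have n: "n \<noteq> 0" using v by (cases n) auto
  note b = basis_completion[OF v]
  obtain vs where vs: "basis_completion v = v # vs"
    using b n by (cases "basis_completion v") auto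
  have ws: "set ws \<subseteq> carrier_vec n" "corthogonal ws" "length ws = n"
    using gram_schmidt_result[OF _ _ _ ws_def] b by auto
  have hd: "ws ! 0 = v"
    proof -
    have "hd ws = v" using gram_schmidt_hd[OF v(1), of vs] by (simp add: ws_def vs)
    then show ?thesis using ws(3) n by (metis hd_conv_nth list.size(3))
  qed
  define nm where "nm j = sqrt (ws ! j \<bullet> ws ! j)" for j
  define W where "W = mat n n (\<lambda>(i,j). ws ! j $ i / nm j)"
  have wsc: "ws ! j \<in> carrier_vec n" if "j < n" for j using ws that by auto
  have orth: "(ws ! i \<bullet> ws ! j = 0) = (i \<noteq> j)" if "i < n" "j < n" for i j
    using corthogonalD[OF ws(2), of i j] that ws(3) by (simp add: conjugate_vec_def)
  have pos: "ws ! j \<bullet> ws ! j \<ge> 0" for j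
    by (auto simp: scalar_prod_def intro!: sum_nonneg)
  show thesis
  proof
    show "W \<in> carrier_mat n n" by (simp add: W_def)
    show "transpose_mat W * W = 1\<^sub>m n"
    proof (rule eq_matI)
      fix i j assume "i < dim_row (1\<^sub>m n :: real mat)" "j < dim_col (1\<^sub>m n :: real mat)"
      then have ij: "i < n" "j < n" by auto
      have "(transpose_mat W * W) $$ (i,j) = (\<Sum>k<n. ws ! i $ k / nm i * (ws ! j $ k / nm j))"
        using ij by (simp add: W_def scalar_prod_def lessThan_atLeast0)
      also have "\<dots> = (ws ! i \<bullet> ws ! j) / (nm i * nm j)"
        using wsc[OF ij(2)] by (simp add: scalar_prod_def lessThan_atLeast0 sum_divide_distrib)
      also have "\<dots> = (if i = j then 1 else 0)"
        using orth[OF ij] pos[of i] by (auto simp: nm_def)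
      finally show "(transpose_mat W * W) $$ (i,j) = (1\<^sub>m n :: real mat) $$ (i,j)" using ij by simp
    qed (auto simp: W_def)
    show "col W 0 = (1 / nm 0) \<cdot>\<^sub>v v"
      using n v by (intro eq_vecI) (auto simp: W_def hd)
  qed
qed

lemma four_block_one: "four_block_mat (1\<^sub>m 1) (0\<^sub>m 1 n) (0\<^sub>m n 1) (1\<^sub>m n) = (1\<^sub>m (Suc n) :: real mat)"
  by (rule eq_matI) auto

text \<open>
  Induction on the dimension: in an orthonormal basis whose first member is an eigenvector, the
  first column of $A$ is a multiple of the first unit vector, and by symmetry so is the first row.
  What remains is a symmetric block that is smaller by one.
\<close>

theorem real_spectral_theorem:
  fixes A :: "real mat"
  assumes "A \<in> carrier_mat n n" and "transpose_mat A = A"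
  shows "\<exists>P D. P \<in> carrier_mat n n \<and> D \<in> carrier_mat n n \<and> diagonal_mat D \<and>
    transpose_mat P * P = 1\<^sub>m n \<and> transpose_mat P * A * P = D"
  using assms
proof (induction n arbitrary: A)
  case 0
  then show ?case
    by (intro exI[of _ "1\<^sub>m 0"]) (auto simp: diagonal_mat_def)
next
  case (Suc n)
  note A = Suc.prems(1) and sym = Suc.prems(2)
  obtain e where "eigenvalue A e"
    using symmetric_real_eigenvalue_exists[OF A sym] by auto
  then obtain v where v: "v \<in> carrier_vec (Suc n)" "v \<noteq> 0\<^sub>v (Suc n)" and ev: "A *\<^sub>v v = e \<cdot>\<^sub>v v"
    using A by (auto simp: eigenvalue_def eigenvector_def)
  obtain W c where W: "W \<in> carrier_mat (Suc n) (Suc n)" and WW: "transpose_mat W * W = 1\<^sub>m (Suc n)"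
    and W0: "col W 0 = c \<cdot>\<^sub>v v"
    using orthogonal_mat_with_first_column[OF v] by blast
  have Wt: "transpose_mat W \<in> carrier_mat (Suc n) (Suc n)" using W by simp
  define B where "B = transpose_mat W * A * W"
  have B: "B \<in> carrier_mat (Suc n) (Suc n)" using W A by (simp add: B_def)
  have symB: "transpose_mat B = B"
    unfolding B_def using W A Wt
    by (simp add: transpose_mult[of _ "Suc n" "Suc n" _ "Suc n"] sym assoc_mult_mat[of _ "Suc n" "Suc n" _ "Suc n" _ "Suc n"])
  have col0: "B $$ (i,0) = (if i = 0 then e else 0)" if i: "i < Suc n" for i
  proof -
    have "col (A * W) 0 = e \<cdot>\<^sub>v col W 0"
    proof -
      have "col (A * W) 0 = A *\<^sub>v col W 0" using A W by (intro eq_vecI) auto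
      also have "\<dots> = c \<cdot>\<^sub>v (A *\<^sub>v v)" unfolding W0 using A v by (simp add: mult_mat_vec)
      also have "\<dots> = e \<cdot>\<^sub>v col W 0" by (simp add: ev W0 smult_smult_assoc mult.commute)
      finally show ?thesis .
    qed
    then have "B $$ (i,0) = row (transpose_mat W) i \<bullet> (e \<cdot>\<^sub>v col W 0)"
      unfolding B_def using i A W Wt by (simp add: assoc_mult_mat[OF Wt A W])
    also have "\<dots> = e * (row (transpose_mat W) i \<bullet> col W 0)" using W i by simp
    also have "row (transpose_mat W) i \<bullet> col W 0 = (transpose_mat W * W) $$ (i,0)"
      using i W by simp
    finally show ?thesis using i by (simp add: WW)
  qed
  have row0: "B $$ (0,j) = (if j = 0 then e else 0)" if "j < Suc n" for j
    using arg_cong[OF symB, of "\<lambda>M. M $$ (0,j)"] B that col0[OF that] by simp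
  define B' where "B' = mat n n (\<lambda>(i,j). B $$ (Suc i, Suc j))"
  have B': "B' \<in> carrier_mat n n" by (simp add: B'_def)
  have symB': "transpose_mat B' = B'"
  proof (rule eq_matI)
    fix i j assume "i < dim_row B'" "j < dim_col B'"
    then show "transpose_mat B' $$ (i,j) = B' $$ (i,j)"
      using arg_cong[OF symB, of "\<lambda>M. M $$ (Suc i,Suc j)"] B by (simp add: B'_def)
  qed (use B' in auto)
  define E where "E = mat 1 1 (\<lambda>_. e)"
  have E: "E \<in> carrier_mat 1 1" by (simp add: E_def)
  have Bblock: "B = four_block_mat E (0\<^sub>m 1 n) (0\<^sub>m n 1) B'"
    using B col0 row0 by (intro eq_matI) (auto simp: E_def B'_def)
  obtain P' D' where P': "P' \<in> carrier_mat n n" and D': "D' \<in> carrier_mat n n" "diagonal_mat D'"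
    and PP': "transpose_mat P' * P' = 1\<^sub>m n" and PD': "transpose_mat P' * B' * P' = D'"
    using Suc.IH[OF B' symB'] by blast
  define Q where "Q = four_block_mat (1\<^sub>m 1) (0\<^sub>m 1 n) (0\<^sub>m n 1) P'"
  define D where "D = four_block_mat E (0\<^sub>m 1 n) (0\<^sub>m n 1) D'"
  have Q: "Q \<in> carrier_mat (Suc n) (Suc n)" by (rule carrier_matI) (use P' in \<open>auto simp: Q_def\<close>)
  have Qt: "transpose_mat Q \<in> carrier_mat (Suc n) (Suc n)" using Q by simp
  have Qt_block: "transpose_mat Q = four_block_mat (1\<^sub>m 1) (0\<^sub>m 1 n) (0\<^sub>m n 1) (transpose_mat P')"
    unfolding Q_def by (subst transpose_four_block_mat) (use P' in auto)
  have QQ: "transpose_mat Q * Q = 1\<^sub>m (Suc n)"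
    unfolding Qt_block unfolding Q_def
    by (subst mult_four_block_mat[of _ 1 1 _ n _ n _ _ 1 _ n]) (use P' PP' four_block_one[of n] in auto)
  have QB: "transpose_mat Q * B = four_block_mat E (0\<^sub>m 1 n) (0\<^sub>m n 1) (transpose_mat P' * B')"
    unfolding Qt_block Bblock
    by (subst mult_four_block_mat[of _ 1 1 _ n _ n _ _ 1 _ n]) (use P' B' E in auto)
  have QBQ: "transpose_mat Q * B * Q = D"
    unfolding QB unfolding Q_def D_def
    by (subst mult_four_block_mat[of _ 1 1 _ n _ n _ _ 1 _ n]) (use P' B' E PD' in auto)
  note assoc = assoc_mult_mat[of _ "Suc n" "Suc n" _ "Suc n" _ "Suc n"]
  have t: "transpose_mat (W * Q) = transpose_mat Q * transpose_mat W"
    by (rule transpose_mult[OF W Q])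
  have "transpose_mat (W * Q) * (W * Q) = transpose_mat Q * (transpose_mat W * W) * Q"
    unfolding t using W Q Wt Qt by (simp add: assoc)
  then have 1: "transpose_mat (W * Q) * (W * Q) = 1\<^sub>m (Suc n)"
    using Qt by (simp add: WW QQ)
  have "transpose_mat (W * Q) * A * (W * Q) = transpose_mat Q * B * Q"
    unfolding t B_def using W Q Wt Qt A by (simp add: assoc)
  then have 2: "transpose_mat (W * Q) * A * (W * Q) = D" by (simp add: QBQ)
  have 3: "D \<in> carrier_mat (Suc n) (Suc n)" by (rule carrier_matI) (use D' E in \<open>auto simp: D_def\<close>)
  have 4: "diagonal_mat D"
    using D' E by (auto simp: diagonal_mat_def D_def)
  show ?case using 1 2 3 4 W Q by (intro exI[of _ "W * Q"] exI[of _ D]) auto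
qed

text \<open>
  The spectral theorem in coordinates: the \<open>k\<close>-th eigenvector is \<open>\<lambda>i. p i k\<close> and belongs to the
  eigenvalue \<open>b k\<close>. Indexing the eigenvalues by \<open>k < n\<close> lists them with multiplicity, so that
  spectral sums become sums over \<open>k\<close>.
\<close>

locale orthonormal_eigenbasis =
  fixes A :: "real mat" and n :: nat and b :: "nat \<Rightarrow> real" and p :: "nat \<Rightarrow> nat \<Rightarrow> real"
  assumes A: "A \<in> carrier_mat n n"
    and rows: "\<And>i j. \<lbrakk>i < n; j < n\<rbrakk> \<Longrightarrow> (\<Sum>k<n. p i k * p j k) = (if i = j then 1 else 0)"
    and cols: "\<And>k l. \<lbrakk>k < n; l < n\<rbrakk> \<Longrightarrow> (\<Sum>i<n. p i k * p i l) = (if k = l then 1 else 0)"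
    and expansion: "\<And>i j. \<lbrakk>i < n; j < n\<rbrakk> \<Longrightarrow> A $$ (i,j) = (\<Sum>k<n. b k * p i k * p j k)"
    and char_poly: "char_poly A = (\<Prod>k<n. [:- b k, 1:])"

lemma orthonormal_eigenbasis_exists:
  assumes A: "A \<in> carrier_mat n n" and sym: "transpose_mat A = A"
  obtains b p where "orthonormal_eigenbasis A n b p"
proof -
  obtain P D where P: "P \<in> carrier_mat n n" and D: "D \<in> carrier_mat n n" "diagonal_mat D"
    and PP: "transpose_mat P * P = 1\<^sub>m n" and PAP: "transpose_mat P * A * P = D"
    using real_spectral_theorem[OF A sym] by blast
  have Pt: "transpose_mat P \<in> carrier_mat n n" using P by simp
  have PP': "P * transpose_mat P = 1\<^sub>m n"
    by (rule mat_mult_left_right_inverse[OF Pt P PP])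
  note assoc = assoc_mult_mat[of _ n n _ n _ n]
  have "P * D * transpose_mat P = (P * transpose_mat P) * A * (P * transpose_mat P)"
    unfolding PAP[symmetric] using P Pt A by (simp add: assoc)
  then have A_eq: "A = P * D * transpose_mat P" using A by (simp add: PP')
  have D0: "D $$ (i,j) = 0" if "i < n" "j < n" "i \<noteq> j" for i j
    using D that by (auto simp: diagonal_mat_def)
  have "similar_mat_wit A D P (transpose_mat P)"
    by (rule similar_mat_witI[of _ _ n]) (use P Pt A D PP PP' A_eq in auto)
  then have "char_poly A = char_poly D"
    by (intro char_poly_similar) (auto simp: similar_mat_def)
  also have "\<dots> = (\<Prod>a\<leftarrow>diag_mat D. [:- a, 1:])"
    by (rule char_poly_upper_triangular[OF D(1)]) (use D in \<open>auto simp: diagonal_mat_def\<close>)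
  also have "\<dots> = (\<Prod>k<n. [:- (D $$ (k,k)), 1:])"
  proof -
    have "diag_mat D = map (\<lambda>k. D $$ (k,k)) [0..<n]" using D by (simp add: diag_mat_def)
    then have "(\<Prod>a\<leftarrow>diag_mat D. [:- a, 1:]) = prod_list (map (\<lambda>k. [:- (D $$ (k,k)), 1:]) [0..<n])"
      by (simp only: map_map o_def)
    also have "\<dots> = (\<Prod>k\<in>set [0..<n]. [:- (D $$ (k,k)), 1:])"
      by (rule prod.distinct_set_conv_list[symmetric]) simp
    finally show ?thesis by (simp only: set_upt lessThan_atLeast0)
  qed
  finally have cp: "char_poly A = (\<Prod>k<n. [:- (D $$ (k,k)), 1:])" .
  have "orthonormal_eigenbasis A n (\<lambda>k. D $$ (k,k)) (\<lambda>i k. P $$ (i,k))"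
  proof
    fix i j assume ij: "i < n" "j < n"
    show "(\<Sum>k<n. P $$ (i,k) * P $$ (j,k)) = (if i = j then 1 else 0)"
      using arg_cong[OF PP', of "\<lambda>M. M $$ (i,j)"] ij P
      by (simp add: scalar_prod_def lessThan_atLeast0)
    show "(\<Sum>k<n. P $$ (k,i) * P $$ (k,j)) = (if i = j then 1 else 0)"
      using arg_cong[OF PP, of "\<lambda>M. M $$ (i,j)"] ij P
      by (simp add: scalar_prod_def lessThan_atLeast0)
    have PD: "(P * D) $$ (i,k) = P $$ (i,k) * D $$ (k,k)" if k: "k < n" for k
    proof -
      have "(P * D) $$ (i,k) = (\<Sum>l<n. P $$ (i,l) * D $$ (l,k))"
        using ij k P D by (simp add: scalar_prod_def lessThan_atLeast0)
      also have "\<dots> = (\<Sum>l<n. if l = k then P $$ (i,k) * D $$ (k,k) else 0)"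
        by (intro sum.cong refl) (use D0 k in auto)
      finally show ?thesis using k by simp
    qed
    define M where "M = P * D"
    have M: "M \<in> carrier_mat n n" and "A = M * transpose_mat P" using P D A_eq by (auto simp: M_def)
    then have "A $$ (i,j) = (\<Sum>k<n. M $$ (i,k) * P $$ (j,k))"
      using ij P by (simp add: scalar_prod_def lessThan_atLeast0)
    also have "\<dots> = (\<Sum>k<n. D $$ (k,k) * P $$ (i,k) * P $$ (j,k))"
      by (intro sum.cong refl) (simp add: PD M_def)
    finally show "A $$ (i,j) = (\<Sum>k<n. D $$ (k,k) * P $$ (i,k) * P $$ (j,k))" .
  qed (use A cp in auto)
  then show thesis by (rule that)
qed

lemma sum_delta_square:
  fixes n :: nat
  shows "(\<Sum>i<n. \<Sum>j<n. f i j * (if i = j then 1 else 0 :: real)) = (\<Sum>i<n. f i i)"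
proof (intro sum.cong refl)
  fix i assume "i \<in> {..<n}"
  have "(\<Sum>j<n. f i j * (if i = j then 1 else 0 :: real)) = (\<Sum>j<n. if j = i then f i i else 0)"
    by (intro sum.cong) auto
  then show "(\<Sum>j<n. f i j * (if i = j then 1 else 0 :: real)) = f i i"
    using \<open>i \<in> {..<n}\<close> by simp
qed

lemma order_prod_linear_factors:
  fixes b :: "nat \<Rightarrow> real"
  shows "Polynomial.order x (\<Prod>k<n. [:- b k, 1:]) = card {k. k < n \<and> b k = x}"
proof (induction n)
  case (Suc n)
  have "{k. k < Suc n \<and> b k = x} = (if b n = x then insert n {k. k < n \<and> b k = x} else {k. k < n \<and> b k = x})"
    by (auto simp: less_Suc_eq)
  moreover have "Polynomial.order x (\<Prod>k<Suc n. [:- b k, 1:]) =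
      Polynomial.order x (\<Prod>k<n. [:- b k, 1:]) + Polynomial.order x [:- b n, 1:]"
    by (simp add: order_mult del: mult_pCons_right mult_pCons_left)
  moreover have "Polynomial.order x [:- b n, 1:] = (if b n = x then 1 else 0)"
    using order_linear[of "b n"] by (auto intro!: order_0I)
  ultimately show ?case using Suc by simp
qed simp

context orthonormal_eigenbasis
begin

definition coord :: "(nat \<Rightarrow> real) \<Rightarrow> nat \<Rightarrow> real" where
  "coord x k = (\<Sum>i<n. p i k * x i)"

lemma quadratic_form_eq:
  "(\<Sum>i<n. \<Sum>j<n. A $$ (i,j) * x i * x j) = (\<Sum>k<n. b k * (coord x k)\<^sup>2)"
proof -
  have "(\<Sum>i<n. \<Sum>j<n. A $$ (i,j) * x i * x j) =
      (\<Sum>i<n. \<Sum>j<n. \<Sum>k<n. b k * (p i k * x i * (p j k * x j)))"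
    by (intro sum.cong refl) (simp add: expansion sum_distrib_right sum_distrib_left mult_ac)
  also have "\<dots> = (\<Sum>i<n. \<Sum>k<n. \<Sum>j<n. b k * (p i k * x i * (p j k * x j)))"
    by (rule sum.cong[OF refl], rule sum.swap)
  also have "\<dots> = (\<Sum>k<n. \<Sum>i<n. \<Sum>j<n. b k * (p i k * x i * (p j k * x j)))"
    by (rule sum.swap)
  also have "\<dots> = (\<Sum>k<n. b k * (\<Sum>i<n. \<Sum>j<n. p i k * x i * (p j k * x j)))"
    by (simp only: sum_distrib_left)
  also have "\<dots> = (\<Sum>k<n. b k * (coord x k)\<^sup>2)"
    by (simp only: coord_def power2_eq_square sum_product)
  finally show ?thesis .
qed

lemma norm_eq: "(\<Sum>i<n. (x i)\<^sup>2) = (\<Sum>k<n. (coord x k)\<^sup>2)"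
proof -
  have "(\<Sum>k<n. (coord x k)\<^sup>2) = (\<Sum>k<n. \<Sum>i<n. \<Sum>j<n. p i k * x i * (p j k * x j))"
    by (simp add: coord_def power2_eq_square sum_product)
  also have "\<dots> = (\<Sum>i<n. \<Sum>k<n. \<Sum>j<n. p i k * x i * (p j k * x j))"
    by (rule sum.swap)
  also have "\<dots> = (\<Sum>i<n. \<Sum>j<n. \<Sum>k<n. p i k * x i * (p j k * x j))"
    by (rule sum.cong[OF refl], rule sum.swap)
  also have "\<dots> = (\<Sum>i<n. \<Sum>j<n. x i * x j * (\<Sum>k<n. p i k * p j k))"
    by (intro sum.cong refl) (simp add: sum_distrib_left mult_ac)
  also have "\<dots> = (\<Sum>i<n. \<Sum>j<n. x i * x j * (if i = j then 1 else 0))"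
    by (intro sum.cong refl) (simp only: rows lessThan_iff)
  also have "\<dots> = (\<Sum>i<n. (x i)\<^sup>2)"
    by (simp only: sum_delta_square power2_eq_square)
  finally show ?thesis by simp
qed

lemma coord_column: "\<lbrakk>k < n; l < n\<rbrakk> \<Longrightarrow> coord (\<lambda>i. p i l) k = (if k = l then 1 else 0)"
  by (simp add: coord_def cols)

lemma coord_linear: "coord (\<lambda>i. s * x i + t * y i) k = s * coord x k + t * coord y k"
  by (simp add: coord_def sum.distrib sum_distrib_left distrib_left mult_ac)

lemma eigenvector_column:
  assumes "i < n" "k < n"
  shows "(\<Sum>j<n. A $$ (i,j) * p j k) = b k * p i k"
proof -
  have "(\<Sum>j<n. A $$ (i,j) * p j k) = (\<Sum>j<n. \<Sum>l<n. b l * p i l * (p j l * p j k))"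
    by (rule sum.cong[OF refl]) (use assms in \<open>simp add: expansion sum_distrib_left sum_distrib_right mult_ac\<close>)
  also have "\<dots> = (\<Sum>l<n. \<Sum>j<n. b l * p i l * (p j l * p j k))" by (rule sum.swap)
  also have "\<dots> = (\<Sum>l<n. b l * p i l * (\<Sum>j<n. p j l * p j k))" by (simp add: sum_distrib_left)
  also have "\<dots> = (\<Sum>l<n. if l = k then b k * p i k else 0)"
    by (intro sum.cong refl) (use assms cols in auto)
  finally show ?thesis using assms by simp
qed

lemma trace_eq: "(\<Sum>i<n. A $$ (i,i)) = (\<Sum>k<n. b k)"
proof -
  have "(\<Sum>i<n. A $$ (i,i)) = (\<Sum>i<n. \<Sum>k<n. b k * (p i k * p i k))"
    by (intro sum.cong refl) (simp add: expansion mult_ac)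
  also have "\<dots> = (\<Sum>k<n. b k * (\<Sum>i<n. p i k * p i k))"
    by (subst sum.swap) (simp add: sum_distrib_left)
  finally show ?thesis by (simp add: cols)
qed

text \<open>
  Both sides are the trace of $A^2$.
\<close>

lemma sum_square_entries_eq: "(\<Sum>i<n. \<Sum>j<n. (A $$ (i,j))\<^sup>2) = (\<Sum>k<n. (b k)\<^sup>2)"
proof -
  have "(\<Sum>i<n. \<Sum>j<n. (A $$ (i,j))\<^sup>2) =
      (\<Sum>i<n. \<Sum>j<n. \<Sum>k<n. b k * p i k * (A $$ (i,j) * p j k))"
  proof (intro sum.cong refl)
    fix i j assume "i \<in> {..<n}" "j \<in> {..<n}"
    then have "(A $$ (i,j))\<^sup>2 = A $$ (i,j) * (\<Sum>k<n. b k * p i k * p j k)"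
      using expansion[of i j] by (simp add: power2_eq_square)
    also have "\<dots> = (\<Sum>k<n. b k * p i k * (A $$ (i,j) * p j k))"
      by (simp add: sum_distrib_left mult_ac)
    finally show "(A $$ (i,j))\<^sup>2 = (\<Sum>k<n. b k * p i k * (A $$ (i,j) * p j k))" .
  qed
  also have "\<dots> = (\<Sum>i<n. \<Sum>k<n. b k * p i k * (\<Sum>j<n. A $$ (i,j) * p j k))"
    by (subst sum.swap) (simp add: sum_distrib_left)
  also have "\<dots> = (\<Sum>i<n. \<Sum>k<n. (b k)\<^sup>2 * (p i k * p i k))"
    by (intro sum.cong refl) (simp add: eigenvector_column power2_eq_square)
  also have "\<dots> = (\<Sum>k<n. (b k)\<^sup>2 * (\<Sum>i<n. p i k * p i k))"
    by (subst sum.swap) (simp add: sum_distrib_left)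
  finally show ?thesis by (simp add: cols)
qed

lemma eigenvalue_iff: "eigenvalue A x \<longleftrightarrow> (\<exists>k<n. b k = x)"
  unfolding eigenvalue_root_char_poly[OF A] char_poly by (auto simp: poly_prod)

lemma spectral_pow_eq: "spectral_pow A = (\<Sum>k<n. \<bar>b k\<bar>)"
proof -
  have "spectral_pow A = (\<Sum>x\<in>b ` {..<n}. real (card {k. k < n \<and> b k = x}) * \<bar>x\<bar>)"
    unfolding spectral_pow_def eigenvalue_iff char_poly order_prod_linear_factors
    by (intro sum.cong) auto
  also have "\<dots> = (\<Sum>x\<in>b ` {..<n}. \<Sum>k\<in>{k\<in>{..<n}. b k = x}. \<bar>b k\<bar>)"
    by (intro sum.cong refl) simp
  also have "\<dots> = (\<Sum>k<n. \<bar>b k\<bar>)"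
    by (rule sum.image_gen[symmetric]) simp
  finally show ?thesis .
qed

end

section \<open>Eigenvalues of matrices with entries between 0 and 1\<close>

text \<open>
  The largest possible number of edges of a bipartite graph on \<open>m\<close> vertices.
\<close>

definition balanced_product :: "nat \<Rightarrow> real" where
  "balanced_product m = of_int (\<lfloor>real m / 2\<rfloor> * \<lceil>real m / 2\<rceil>)"

lemma floor_ceiling_half:
  "\<lfloor>real m / 2\<rfloor> = int (m div 2)" "\<lceil>real m / 2\<rceil> = int ((m + 1) div 2)"
proof -
  show "\<lfloor>real m / 2\<rfloor> = int (m div 2)"
    using floor_divide_of_nat_eq[of m 2, where 'a = real] by simp
  show "\<lceil>real m / 2\<rceil> = int ((m + 1) div 2)"
    by (cases "even m") (auto elim!: evenE oddE simp: ceiling_eq_iff)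
qed

lemma product_le_balanced_product:
  assumes "p + q = m"
  shows "real p * real q \<le> balanced_product m"
proof -
  have "int p * int q \<le> int (m div 2) * int ((m + 1) div 2)"
  proof (cases "even m")
    case True
    then obtain k where k: "m = 2 * k" by auto
    have "0 \<le> (int p - int k) * (int p - int k)" by simp
    moreover have q: "int q = 2 * int k - int p" using assms k by simp
    ultimately show ?thesis unfolding q using k by (simp add: algebra_simps)
  next
    case False
    then obtain k where k: "m = 2 * k + 1" by (auto elim: oddE)
    have "0 \<le> (int p - int k) * (int p - int k - 1)"
      by (cases "int p \<le> int k") (auto intro: mult_nonpos_nonpos)
    moreover have q: "int q = 2 * int k + 1 - int p" using assms k by simp
    ultimately show ?thesis unfolding q using k by (simp add: algebra_simps)
  qed
  then have "real_of_int (int p * int q) \<le> real_of_int (int (m div 2) * int ((m + 1) div 2))"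
    by (simp only: of_int_le_iff)
  then show ?thesis by (simp add: balanced_product_def floor_ceiling_half)
qed

lemma sum_power2_le_card:
  fixes u :: "'a \<Rightarrow> real"
  shows "(\<Sum>i\<in>I. u i)\<^sup>2 \<le> card I * (\<Sum>i\<in>I. (u i)\<^sup>2)"
  using sum_squared_le_sum_of_squares[of u I] by (simp add: mult.commute)

text \<open>
  Constantine's bound on the least eigenvalue, for quadratic forms. Only products of a nonnegative
  and a negative coordinate of $x$ contribute negatively, and as the coefficients are at most 1 their
  total is at least $-2UW$, where $U$ and $W$ are the sums of the absolute values of the coordinates
  of either sign. By Cauchy-Schwarz $U \le \sqrt{|P|}\,\|x_P\|$ and
  $W \le \sqrt{|N|}\,\|x_N\|$, where $P$ and $N$ are the sets of coordinates of either sign, and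
  $2\,\|x_P\|\,\|x_N\| \le \|x\|^2$. Finally $|P|\,|N|$ is largest when $P$ and $N$ are balanced.

  The bound is stated for forms and not for eigenvalues because it is also applied to the
  complementary matrix with entries $1 - a_{ij}$.
\<close>

lemma quadratic_form_ge:
  fixes a :: "nat \<Rightarrow> nat \<Rightarrow> real"
  assumes a: "\<And>i j. \<lbrakk>i < n; j < n\<rbrakk> \<Longrightarrow> 0 \<le> a i j \<and> a i j \<le> 1"
  shows "(\<Sum>i<n. \<Sum>j<n. a i j * x i * x j) \<ge> - sqrt (balanced_product n) * (\<Sum>i<n. (x i)\<^sup>2)"
proof -
  define u w where "u i = max (x i) 0" and "w i = max (- x i) 0" for i
  define P N where "P = {i. i < n \<and> x i \<ge> 0}" and "N = {i. i < n \<and> x i < 0}"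
  define U W where "U = (\<Sum>i<n. u i)" and "W = (\<Sum>i<n. w i)"
  have nn: "u i \<ge> 0" "w i \<ge> 0" for i by (auto simp: u_def w_def)
  have UW: "U \<ge> 0" "W \<ge> 0" by (auto simp: U_def W_def nn intro: sum_nonneg)
  have entry: "a i j * x i * x j \<ge> - (u i * w j + w i * u j)" if ij: "i < n" "j < n" for i j
  proof -
    define r v where "r = u i * w j + w i * u j" and "v = u i * u j + w i * w j"
    have rv: "r \<ge> 0" "v \<ge> 0" using nn by (auto simp: r_def v_def)
    have x: "x i = u i - w i" "x j = u j - w j" by (auto simp: u_def w_def)
    have "a i j * r \<le> 1 * r" by (rule mult_right_mono) (use a[OF ij] rv in auto)
    moreover have "0 \<le> a i j * v" using a[OF ij] rv by simp
    moreover have "a i j * x i * x j = a i j * v - a i j * r"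
      unfolding x r_def v_def by (simp add: algebra_simps)
    ultimately show ?thesis unfolding r_def[symmetric] by linarith
  qed
  have "(\<Sum>i<n. \<Sum>j<n. a i j * x i * x j) \<ge> (\<Sum>i<n. \<Sum>j<n. - (u i * w j + w i * u j))"
    by (intro sum_mono) (use entry in auto)
  moreover have "(\<Sum>i<n. \<Sum>j<n. - (u i * w j + w i * u j)) = - (2 * (U * W))"
    by (simp add: U_def W_def sum_product sum.distrib sum_negf sum_subtractf)
      (subst sum.swap, simp add: mult.commute)
  ultimately have 1: "(\<Sum>i<n. \<Sum>j<n. a i j * x i * x j) \<ge> - (2 * (U * W))" by simp
  define X where "X = (\<Sum>i<n. (x i)\<^sup>2)"
  define UU WW where "UU = (\<Sum>i\<in>P. (u i)\<^sup>2)" and "WW = (\<Sum>i\<in>N. (w i)\<^sup>2)"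
  have U: "U = (\<Sum>i\<in>P. u i)" unfolding U_def
    by (rule sum.mono_neutral_right) (auto simp: P_def u_def)
  have W: "W = (\<Sum>i\<in>N. w i)" unfolding W_def
    by (rule sum.mono_neutral_right) (auto simp: N_def w_def)
  have PN: "{..<n} = P \<union> N" "P \<inter> N = {}" "finite P" "finite N" by (auto simp: P_def N_def)
  have "card P + card N = n" using PN by (metis card_Un_disjoint card_lessThan)
  have UUWW: "UU + WW = X"
    unfolding X_def PN(1) sum.union_disjoint[OF PN(3,4,2)] UU_def WW_def
    by (intro arg_cong2[of _ _ _ _ "(+)"] sum.cong refl) (auto simp: P_def N_def u_def w_def)
  have nn': "UU \<ge> 0" "WW \<ge> 0" by (auto simp: UU_def WW_def sum_nonneg)
  have "(U * W)\<^sup>2 = U\<^sup>2 * W\<^sup>2" by (simp add: power_mult_distrib)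
  also have "\<dots> \<le> (card P * UU) * (card N * WW)"
    unfolding U W UU_def WW_def by (intro mult_mono sum_power2_le_card) (auto simp: sum_nonneg)
  finally have "(2 * (U * W))\<^sup>2 \<le> (real (card P) * real (card N)) * (4 * UU * WW)"
    by (simp add: power_mult_distrib mult_ac)
  also have "\<dots> \<le> balanced_product n * X\<^sup>2"
  proof (rule mult_mono)
    show "real (card P) * real (card N) \<le> balanced_product n"
      by (rule product_le_balanced_product) fact
    have "0 \<le> (UU - WW)\<^sup>2" by simp
    then show "4 * UU * WW \<le> X\<^sup>2"
      unfolding UUWW[symmetric] by (simp add: power2_eq_square algebra_simps)
  qed (use nn' in \<open>auto simp: balanced_product_def\<close>)
  finally have "2 * (U * W) \<le> sqrt (balanced_product n * X\<^sup>2)"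
    by (rule real_le_rsqrt)
  also have "\<dots> = sqrt (balanced_product n) * X"
    by (simp add: real_sqrt_mult X_def sum_nonneg)
  finally show ?thesis using 1 by (simp add: X_def)
qed

lemma exists_nontrivial_kernel:
  fixes y z :: real
  obtains s t where "s * y + t * z = 0" "s \<noteq> 0 \<or> t \<noteq> 0"
proof (cases "y = 0")
  case True
  then show thesis using that[of 1 0] by simp
next
  case False
  then show thesis using that[of "-z" y] by simp
qed

context orthonormal_eigenbasis
begin

lemma eigenvalue_ge_balanced:
  assumes "\<And>i j. \<lbrakk>i < n; j < n\<rbrakk> \<Longrightarrow> 0 \<le> A $$ (i,j) \<and> A $$ (i,j) \<le> 1" and k: "k < n"
  shows "b k \<ge> - sqrt (balanced_product n)"
proof -
  have "(\<Sum>i<n. \<Sum>j<n. A $$ (i,j) * p i k * p j k) = (\<Sum>l<n. if l = k then b k else 0)"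
    unfolding quadratic_form_eq by (intro sum.cong refl) (use k coord_column in auto)
  moreover have "(\<Sum>i<n. (p i k)\<^sup>2) = 1" using cols[OF k k] by (simp add: power2_eq_square)
  ultimately show ?thesis
    using quadratic_form_ge[of n "\<lambda>i j. A $$ (i,j)" "\<lambda>i. p i k"] assms by simp
qed

text \<open>
  Two orthogonal eigenvectors span a plane, which contains a nonzero vector $x$ whose coordinates
  sum to zero. On such a vector the forms of $A$ and of the complementary matrix $J - A$, with $J$
  the all-ones matrix, are opposite; hence the lower bound for the latter is an upper bound for
  the former, while in this plane the form of $A$ is at least $c \|x\|^2$.
\<close>

lemma two_eigenvalues_ge_imp_le_balanced:
  assumes entries: "\<And>i j. \<lbrakk>i < n; j < n\<rbrakk> \<Longrightarrow> 0 \<le> A $$ (i,j) \<and> A $$ (i,j) \<le> 1"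
    and kl: "k < n" "l < n" "k \<noteq> l" and c: "b k \<ge> c" "b l \<ge> c"
  shows "c \<le> sqrt (balanced_product n)"
proof -
  obtain s t where st: "s * (\<Sum>i<n. p i k) + t * (\<Sum>i<n. p i l) = 0" "s \<noteq> 0 \<or> t \<noteq> 0"
    by (rule exists_nontrivial_kernel)
  define x where "x = (\<lambda>i. s * p i k + t * p i l)"
  define X where "X = (\<Sum>i<n. (x i)\<^sup>2)"
  have cx: "coord x j = (if j = k then s else 0) + (if j = l then t else 0)" if "j < n" for j
    unfolding x_def coord_linear using that kl by (simp add: coord_column)
  have "(\<Sum>j<n. (coord x j)\<^sup>2) = (\<Sum>j<n. (if j = k then s\<^sup>2 else 0) + (if j = l then t\<^sup>2 else 0))"
    by (intro sum.cong refl) (use cx kl in auto)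
  moreover have Xc: "X = (\<Sum>j<n. (coord x j)\<^sup>2)" unfolding X_def by (rule norm_eq)
  ultimately have X: "X = s\<^sup>2 + t\<^sup>2" using kl by (simp add: sum.distrib)
  then have "X > 0" using st(2) by (simp add: sum_power2_gt_zero_iff)
  have "c * X \<le> (\<Sum>i<n. \<Sum>j<n. A $$ (i,j) * x i * x j)"
    unfolding quadratic_form_eq Xc sum_distrib_left
  proof (rule sum_mono)
    fix j assume "j \<in> {..<n}"
    then have "coord x j = 0 \<or> b j \<ge> c" using cx c by auto
    then show "c * (coord x j)\<^sup>2 \<le> b j * (coord x j)\<^sup>2" by (auto intro: mult_right_mono)
  qed
  also have "\<dots> = - (\<Sum>i<n. \<Sum>j<n. (1 - A $$ (i,j)) * x i * x j)"
  proof -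
    have "(\<Sum>i<n. \<Sum>j<n. x i * x j) = (\<Sum>i<n. x i) * (\<Sum>j<n. x j)" by (simp add: sum_product)
    also have "(\<Sum>i<n. x i) = 0"
      using st(1) by (simp add: x_def sum.distrib sum_distrib_left)
    finally show ?thesis by (simp add: left_diff_distrib sum_subtractf)
  qed
  also have "\<dots> \<le> sqrt (balanced_product n) * X"
    using quadratic_form_ge[of n "\<lambda>i j. 1 - A $$ (i,j)" x] entries by (simp add: X_def)
  finally show ?thesis using \<open>X > 0\<close> by simp
qed

text \<open>
  If there were at most one positive eigenvalue, some nonzero vector of the plane spanned by $y$
  and $z$ would be orthogonal to the eigenvector that belongs to it, and the form would not be
  positive there.
\<close>

lemma two_positive_eigenvalues:
  assumes pos: "\<And>s t. s \<noteq> 0 \<or> t \<noteq> 0 \<Longrightarrow>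
      (\<Sum>i<n. \<Sum>j<n. A $$ (i,j) * (s * y i + t * z i) * (s * y j + t * z j)) > 0"
  obtains k l where "k < n" "l < n" "k \<noteq> l" "b k > 0" "b l > 0"
proof (rule ccontr)
  assume not_thesis: "\<not> thesis"
  note found = that
  have le1: "k = l" if "k < n" "l < n" "b k > 0" "b l > 0" for k l
    using found[of k l] that not_thesis by blast
  obtain k where k: "b l \<le> 0" if "l < n" "l \<noteq> k" for l
  proof (cases "\<exists>k<n. b k > 0")
    case True
    then obtain k where "k < n" "b k > 0" by blast
    then show ?thesis using le1[of _ k] by (intro that[of k]) (meson linorder_not_le)
  next
    case False
    then show ?thesis by (intro that[of 0]) (meson linorder_not_le)
  qed
  obtain s t where st: "s * coord y k + t * coord z k = 0" "s \<noteq> 0 \<or> t \<noteq> 0"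
    by (rule exists_nontrivial_kernel)
  define x where "x = (\<lambda>i. s * y i + t * z i)"
  have "coord x k = 0" using st(1) by (simp add: x_def coord_linear)
  then have "(\<Sum>l<n. b l * (coord x l)\<^sup>2) \<le> 0"
  proof (intro sum_nonpos)
    fix l assume "l \<in> {..<n}"
    then show "b l * (coord x l)\<^sup>2 \<le> 0"
      using k[of l] \<open>coord x k = 0\<close> by (cases "l = k") (auto intro: mult_nonpos_nonneg)
  qed
  then show False
    using pos[OF st(2)] quadratic_form_eq[of x] by (simp add: x_def)
qed

end

section \<open>The extreme eigenvalues and the sum of their absolute values\<close>

context orthonormal_eigenbasis
begin

lemma finite_eigenvalues: "finite {x. eigenvalue A x \<and> P x}"
  by (rule finite_subset[of _ "b ` {..<n}"]) (auto simp: eigenvalue_iff)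

lemma positive_and_negative_eigenvalue:
  assumes tr: "(\<Sum>i<n. A $$ (i,i)) = 0" and nz: "\<exists>i<n. \<exists>j<n. A $$ (i,j) \<noteq> 0"
  shows "\<exists>k<n. b k > 0" and "\<exists>k<n. b k < 0"
proof -
  have sum0: "(\<Sum>k<n. b k) = 0" using tr trace_eq by simp
  have "\<exists>k<n. b k \<noteq> 0"
  proof (rule ccontr)
    assume "\<not> (\<exists>k<n. b k \<noteq> 0)"
    then have "A $$ (i,j) = 0" if "i < n" "j < n" for i j using that by (simp add: expansion)
    then show False using nz by blast
  qed
  then have *: "\<exists>k\<in>{..<n}. b k \<noteq> 0" by blast
  show "\<exists>k<n. b k > 0"
  proof (rule ccontr)
    assume "\<not> (\<exists>k<n. b k > 0)"
    then have "\<forall>k\<in>{..<n}. - b k \<ge> 0" using linorder_not_le by auto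
    moreover have "(\<Sum>k<n. - b k) = 0" using sum0 by (simp add: sum_negf)
    ultimately have "\<forall>k\<in>{..<n}. - b k = 0" by (subst (asm) sum_nonneg_eq_0_iff) auto
    then show False using * by simp
  qed
  show "\<exists>k<n. b k < 0"
  proof (rule ccontr)
    assume "\<not> (\<exists>k<n. b k < 0)"
    then have "\<forall>k\<in>{..<n}. b k \<ge> 0" using linorder_not_le by auto
    then have "\<forall>k\<in>{..<n}. b k = 0" using sum0 by (subst (asm) sum_nonneg_eq_0_iff) auto
    then show False using * by simp
  qed
qed

lemma least_pos_eigenvalue:
  assumes "\<exists>k<n. b k > 0"
  shows "least_pos_eigenvalue A > 0" and "\<exists>k<n. b k = least_pos_eigenvalue A"
    and "\<And>l. \<lbrakk>l < n; b l > 0\<rbrakk> \<Longrightarrow> least_pos_eigenvalue A \<le> b l"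
proof -
  let ?S = "{x. eigenvalue A x \<and> x > 0}"
  have "?S \<noteq> {}" using assms by (auto simp: eigenvalue_iff)
  then have "Min ?S \<in> ?S" using finite_eigenvalues by (intro Min_in)
  then show "least_pos_eigenvalue A > 0" "\<exists>k<n. b k = least_pos_eigenvalue A"
    by (auto simp: least_pos_eigenvalue_def eigenvalue_iff)
  show "least_pos_eigenvalue A \<le> b l" if "l < n" "b l > 0" for l
    unfolding least_pos_eigenvalue_def
    by (rule Min_le[OF finite_eigenvalues]) (use that in \<open>auto simp: eigenvalue_iff\<close>)
qed

lemma greatest_neg_eigenvalue:
  assumes "\<exists>k<n. b k < 0"
  shows "greatest_neg_eigenvalue A < 0" and "\<exists>k<n. b k = greatest_neg_eigenvalue A"
proof -
  let ?S = "{x. eigenvalue A x \<and> x < 0}"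
  have "?S \<noteq> {}" using assms by (auto simp: eigenvalue_iff)
  then have "Max ?S \<in> ?S" using finite_eigenvalues by (intro Max_in)
  then show "greatest_neg_eigenvalue A < 0" "\<exists>k<n. b k = greatest_neg_eigenvalue A"
    by (auto simp: greatest_neg_eigenvalue_def eigenvalue_iff)
qed

text \<open>
  As the eigenvalues sum to zero, each is minus the sum of the others; so its absolute value is at
  most half of $T = \sum_k |\lambda_k|$. Therefore $2 \sum_k \lambda_k^2 \le \sum_k T |\lambda_k| =
  T^2$.
\<close>

lemma spectral_pow_ge:
  assumes tr: "(\<Sum>i<n. A $$ (i,i)) = 0"
  shows "spectral_pow A \<ge> sqrt (2 * (\<Sum>i<n. \<Sum>j<n. (A $$ (i,j))\<^sup>2))"
proof -
  define T where "T = (\<Sum>k<n. \<bar>b k\<bar>)"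
  have half: "2 * \<bar>b k\<bar> \<le> T" if k: "k < n" for k
  proof -
    have "b k + (\<Sum>l\<in>{..<n}-{k}. b l) = 0"
      using tr trace_eq sum.remove[of "{..<n}" k b] k by simp
    then have "\<bar>b k\<bar> = \<bar>\<Sum>l\<in>{..<n}-{k}. b l\<bar>" by linarith
    also have "\<dots> \<le> (\<Sum>l\<in>{..<n}-{k}. \<bar>b l\<bar>)" by (rule sum_abs)
    also have "\<dots> = T - \<bar>b k\<bar>"
      using sum.remove[of "{..<n}" k "\<lambda>l. \<bar>b l\<bar>"] k by (simp add: T_def)
    finally show ?thesis by linarith
  qed
  have "2 * (\<Sum>k<n. (b k)\<^sup>2) = (\<Sum>k<n. (2 * \<bar>b k\<bar>) * \<bar>b k\<bar>)"
    by (simp add: sum_distrib_left power2_eq_square mult.assoc)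
  also have "\<dots> \<le> (\<Sum>k<n. T * \<bar>b k\<bar>)"
    by (intro sum_mono mult_right_mono) (use half in auto)
  also have "\<dots> = T\<^sup>2" by (simp add: T_def sum_distrib_left power2_eq_square)
  finally have "sqrt (2 * (\<Sum>k<n. (b k)\<^sup>2)) \<le> T"
    by (intro real_le_lsqrt) (simp_all add: T_def sum_nonneg)
  then show ?thesis by (simp add: sum_square_entries_eq spectral_pow_eq T_def)
qed

end

section \<open>Graphs with one positive eigenvalue and complete bipartite graphs\<close>

context orthonormal_eigenbasis
begin

text \<open>
  This is the main step of Smith's characterisation of the graphs with a single positive
  eigenvalue. Let \<open>u\<close>, \<open>w\<close> be the ends of an edge, let \<open>v\<close> be adjacent to neither, and let \<open>x\<close> be a
  neighbour of \<open>v\<close>. The form of the adjacency matrix is positive on the plane spanned by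
  $e_u + e_w$ and $e_x + 2 e_v$: the first vector contributes 2, the second 4, and the two are
  paired by at most 2, because $e_v$ is paired with neither $e_u$ nor $e_w$; and $2^2 < 2 \cdot 4$.
\<close>

lemma missing_transitivity_imp_two_positive_eigenvalues:
  assumes entries: "\<And>i j. \<lbrakk>i < n; j < n\<rbrakk> \<Longrightarrow> A $$ (i,j) = (if R i j then 1 else 0)"
    and sym: "\<And>i j. R i j \<Longrightarrow> R j i" and irrefl: "\<And>i. \<not> R i i"
    and v: "u < n" "v < n" "w < n" "x < n"
    and R: "\<not> R u v" "\<not> R v w" "R u w" "R v x"
  obtains k l where "k < n" "l < n" "k \<noteq> l" "b k > 0" "b l > 0"
proof -
  define y where "y i = (if i = u then 1 else 0) + (if i = w then 1 else (0::real))" for i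
  define z where "z i = (if i = x then 1 else 0) + (if i = v then 2 else (0::real))" for i
  have R': "\<not> R v u" "\<not> R w v" "R w u" "R x v" using R sym by blast+
  have distinct: "u \<noteq> w" "u \<noteq> v" "v \<noteq> w" "x \<noteq> v" "x \<noteq> u" "x \<noteq> w"
    using R R' irrefl by blast+
  have sum_y: "(\<Sum>i<n. f i * y i) = f u + f w" for f
  proof -
    have "(\<Sum>i<n. f i * y i) = (\<Sum>i<n. (if i = u then f i else 0) + (if i = w then f i else 0))"
      by (intro sum.cong refl) (simp add: y_def)
    then show ?thesis using v by (simp add: sum.distrib)
  qed
  have sum_z: "(\<Sum>i<n. f i * z i) = f x + 2 * f v" for f
  proof -
    have "(\<Sum>i<n. f i * z i) = (\<Sum>i<n. (if i = x then f i else 0) + (if i = v then 2 * f i else 0))"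
      by (intro sum.cong refl) (simp add: z_def)
    then show ?thesis using v by (simp add: sum.distrib)
  qed
  have sum_yz: "(\<Sum>i<n. f i * (s * y i + t * z i)) = s * (f u + f w) + t * (f x + 2 * f v)" for f s t
  proof -
    have "(\<Sum>i<n. f i * (s * y i + t * z i)) = s * (\<Sum>i<n. f i * y i) + t * (\<Sum>i<n. f i * z i)"
      by (simp add: distrib_left sum.distrib sum_distrib_left mult_ac)
    then show ?thesis by (simp only: sum_y sum_z)
  qed
  define \<kappa> where "\<kappa> = A $$ (u,x) + A $$ (w,x)"
  have \<kappa>: "0 \<le> \<kappa>" "\<kappa> \<le> 2" using v by (auto simp: \<kappa>_def entries)
  have symA: "A $$ (x,u) = A $$ (u,x)" "A $$ (x,w) = A $$ (w,x)"
    using v sym by (auto simp: entries)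
  have form: "(\<Sum>i<n. \<Sum>j<n. A $$ (i,j) * (s * y i + t * z i) * (s * y j + t * z j)) =
      2 * s\<^sup>2 + 2 * s * t * \<kappa> + 4 * t\<^sup>2" (is "?lhs = _") for s t
  proof -
    have "?lhs = (\<Sum>i<n. (\<Sum>j<n. A $$ (i,j) * (s * y j + t * z j)) * (s * y i + t * z i))"
      by (simp add: sum_distrib_right sum_distrib_left mult_ac)
    also have "\<dots> = (\<Sum>i<n. (s * (A $$ (i,u) + A $$ (i,w)) + t * (A $$ (i,x) + 2 * A $$ (i,v))) * (s * y i + t * z i))"
      by (simp only: sum_yz)
    also have "\<dots> = s * (s * 1 + t * A $$ (u,x) + (s * 1 + t * A $$ (w,x))) +
        t * (s * (A $$ (x,u) + A $$ (x,w)) + t * 2 + 2 * (t * 1))"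
      unfolding sum_yz using v R R' irrefl by (simp add: entries)
    also have "\<dots> = 2 * s\<^sup>2 + 2 * s * t * \<kappa> + 4 * t\<^sup>2"
      unfolding symA \<kappa>_def by (simp add: power2_eq_square algebra_simps)
    finally show ?thesis .
  qed
  show thesis
  proof (rule two_positive_eigenvalues[of y z])
    fix s t :: real assume st: "s \<noteq> 0 \<or> t \<noteq> 0"
    \<comment> \<open>completing the square; \<open>\<kappa>\<close> is the number of edges from \<open>x\<close> to \<open>u\<close> and \<open>w\<close>\<close>
    have "2 * s\<^sup>2 + 2 * s * t * \<kappa> + 4 * t\<^sup>2 = 2 * (s + t * \<kappa> / 2)\<^sup>2 + (4 - \<kappa>\<^sup>2 / 2) * t\<^sup>2"
      by (simp add: power2_eq_square field_simps)
    moreover have "\<kappa>\<^sup>2 \<le> 4" using power_mono[OF \<kappa>(2,1), of 2] by simp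
    then have "4 - \<kappa>\<^sup>2 / 2 > 0" by simp
    then have "2 * (s + t * \<kappa> / 2)\<^sup>2 + (4 - \<kappa>\<^sup>2 / 2) * t\<^sup>2 > 0"
    proof (cases "t = 0")
      case True
      then show ?thesis using st by simp
    next
      case False
      then have "(4 - \<kappa>\<^sup>2 / 2) * t\<^sup>2 > 0" using \<open>4 - \<kappa>\<^sup>2 / 2 > 0\<close> by simp
      then show ?thesis by (intro add_nonneg_pos) auto
    qed
    ultimately show "(\<Sum>i<n. \<Sum>j<n. A $$ (i,j) * (s * y i + t * z i) * (s * y j + t * z j)) > 0"
      unfolding form by simp
  qed (rule that)
qed

text \<open>
  Let $S_U$ and $S_V$ be the sums of an eigenvector over the two parts. The eigenvalue equation
  gives $\lambda S_U = |U| S_V$ and $\lambda S_V = |V| S_U$. For $\lambda \ne 0$ the sums cannot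
  vanish, so $\lambda = \pm\sigma$ with $\sigma^2 = |U|\,|V|$. As the trace is zero, both
  signs occur; and counting the nonzero entries gives $\sigma \sum_k |\lambda_k| = \sum_k \lambda_k^2 = 2 \sigma^2$.
\<close>

lemma complete_bipartite_eigenvalues:
  assumes entries: "\<And>i j. \<lbrakk>i < n; j < n\<rbrakk> \<Longrightarrow> A $$ (i,j) = (if (i \<in> U) \<noteq> (j \<in> U) then 1 else 0)"
    and U: "U \<subseteq> {..<n}" "U \<noteq> {}" "U \<noteq> {..<n}"
  defines "\<sigma> \<equiv> sqrt (real (card U) * real (n - card U))"
  shows "least_pos_eigenvalue A = \<sigma>" and "greatest_neg_eigenvalue A = - \<sigma>"
    and "spectral_pow A = 2 * \<sigma>"
proof -
  define V where "V = {..<n} - U"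
  have fin: "finite U" "finite V" using U finite_subset by (auto simp: V_def)
  have UV: "{..<n} = U \<union> V" "U \<inter> V = {}" using U by (auto simp: V_def)
  have cV: "card V = n - card U" using U by (simp add: V_def card_Diff_subset finite_subset)
  define pq where "pq = real (card U) * real (card V)"
  have "V \<noteq> {}" using U by (auto simp: V_def)
  then have pq: "pq > 0" using U fin by (simp add: pq_def card_gt_0_iff)
  have \<sigma>: "\<sigma> = sqrt pq" by (simp add: \<sigma>_def pq_def cV)
  then have \<sigma>0: "\<sigma> > 0" "\<sigma>\<^sup>2 = pq" using pq by auto
  have entries': "A $$ (i,j) = (if (i \<in> U) = (j \<in> U) then 0 else 1)" if "i < n" "j < n" for i j
    using entries[OF that] by auto
  have split: "(\<Sum>i<n. f i) = (\<Sum>i\<in>U. f i) + (\<Sum>i\<in>V. f i)" for f :: "nat \<Rightarrow> real"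
    unfolding UV(1) by (rule sum.union_disjoint) (use fin UV in auto)
  have inn: "i < n" if "i \<in> U \<or> i \<in> V" for i using that UV(1) by blast
  have b: "b k = 0 \<or> (b k)\<^sup>2 = pq" if k: "k < n" for k
  proof (cases "b k = 0")
    case False
    define SU SV where "SU = (\<Sum>j\<in>U. p j k)" and "SV = (\<Sum>j\<in>V. p j k)"
    have eU: "b k * p i k = SV" if i: "i \<in> U" for i
    proof -
      have "b k * p i k = (\<Sum>j\<in>U. A $$ (i,j) * p j k) + (\<Sum>j\<in>V. A $$ (i,j) * p j k)"
        using eigenvector_column[of i k] inn i k by (simp add: split)
      also have "(\<Sum>j\<in>U. A $$ (i,j) * p j k) = 0"
        by (intro sum.neutral) (use i inn in \<open>auto simp: entries'\<close>)
      also have "(\<Sum>j\<in>V. A $$ (i,j) * p j k) = SV"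
        unfolding SV_def by (intro sum.cong refl) (use i inn UV(2) in \<open>auto simp: entries'\<close>)
      finally show ?thesis by simp
    qed
    have eV: "b k * p i k = SU" if i: "i \<in> V" for i
    proof -
      have "b k * p i k = (\<Sum>j\<in>U. A $$ (i,j) * p j k) + (\<Sum>j\<in>V. A $$ (i,j) * p j k)"
        using eigenvector_column[of i k] inn i k by (simp add: split)
      also have "(\<Sum>j\<in>V. A $$ (i,j) * p j k) = 0"
        by (intro sum.neutral) (use i inn UV(2) in \<open>auto simp: entries'\<close>)
      also have "(\<Sum>j\<in>U. A $$ (i,j) * p j k) = SU"
        unfolding SU_def by (intro sum.cong refl) (use i inn UV(2) in \<open>auto simp: entries'\<close>)
      finally show ?thesis by simp
    qed
    have 1: "b k * SU = card U * SV" unfolding SU_def sum_distrib_left by (simp add: eU)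
    have 2: "b k * SV = card V * SU" unfolding SV_def sum_distrib_left by (simp add: eV)
    have "SU \<noteq> 0"
    proof
      assume "SU = 0"
      then have "SV = 0" using 2 False by simp
      then have "p i k = 0" if "i < n" for i
        using eU[of i] eV[of i] that \<open>SU = 0\<close> False UV(1) by auto
      then show False using cols[OF k k] by simp
    qed
    moreover have "(b k)\<^sup>2 * SU = pq * SU"
      using 1 2 by (simp add: power2_eq_square pq_def mult.assoc)
    ultimately show ?thesis by simp
  qed simp
  have abs_b: "\<bar>b k\<bar> * \<sigma> = (b k)\<^sup>2" if "k < n" for k
  proof -
    have "\<bar>b k\<bar> = \<sigma>" if "(b k)\<^sup>2 = pq" using that \<sigma> real_sqrt_abs by metis
    then show ?thesis using b[OF that] \<sigma>0(2) by (auto simp: power2_eq_square)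
  qed
  have "(\<Sum>i<n. \<Sum>j<n. (A $$ (i,j))\<^sup>2) =
      (\<Sum>i\<in>U. (\<Sum>j\<in>U. (A $$ (i,j))\<^sup>2) + (\<Sum>j\<in>V. (A $$ (i,j))\<^sup>2)) +
      (\<Sum>i\<in>V. (\<Sum>j\<in>U. (A $$ (i,j))\<^sup>2) + (\<Sum>j\<in>V. (A $$ (i,j))\<^sup>2))"
    by (simp add: split)
  also have "\<dots> = (\<Sum>i\<in>U. (\<Sum>j\<in>U. 0) + (\<Sum>j\<in>V. 1)) + (\<Sum>i\<in>V. (\<Sum>j\<in>U. 1) + (\<Sum>j\<in>V. 0))"
    by (intro arg_cong2[of _ _ _ _ "(+)"] sum.cong refl) (use inn UV(2) in \<open>auto simp: entries'\<close>)
  also have "\<dots> = 2 * pq" by (simp add: pq_def)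
  finally have sq: "(\<Sum>k<n. (b k)\<^sup>2) = 2 * \<sigma>\<^sup>2" by (simp add: sum_square_entries_eq \<sigma>0)
  have "(\<Sum>k<n. \<bar>b k\<bar>) * \<sigma> = (2 * \<sigma>) * \<sigma>"
    unfolding sum_distrib_right using sq by (simp add: abs_b power2_eq_square)
  then show "spectral_pow A = 2 * \<sigma>" using \<sigma>0 by (simp add: spectral_pow_eq)
  obtain u v where uv: "u \<in> U" "v \<in> V" using U \<open>V \<noteq> {}\<close> by blast
  then have "A $$ (u,v) \<noteq> 0" using inn UV(2) by (auto simp: entries')
  then have nz: "\<exists>i<n. \<exists>j<n. A $$ (i,j) \<noteq> 0" using uv inn by blast
  have tr: "(\<Sum>i<n. A $$ (i,i)) = 0" by (simp add: entries')
  note ex = positive_and_negative_eigenvalue[OF tr nz]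
  have "b k = \<sigma>" if "k < n" "b k > 0" for k using abs_b[OF that(1)] that(2) by (simp add: power2_eq_square)
  then show "least_pos_eigenvalue A = \<sigma>"
    using least_pos_eigenvalue[OF ex(1)] by metis
  have "b k = - \<sigma>" if "k < n" "b k < 0" for k
  proof -
    have "b k * (b k + \<sigma>) = 0"
      using abs_b[OF that(1)] that(2) by (simp add: power2_eq_square algebra_simps)
    then show ?thesis using that(2) by simp
  qed
  then show "greatest_neg_eigenvalue A = - \<sigma>"
    using greatest_neg_eigenvalue[OF ex(2)] by metis
qed

end

section \<open>The pseudo-inverse of a complete multipartite graph\<close>

definition multipartite_mat :: "nat \<Rightarrow> (nat \<Rightarrow> 'c) \<Rightarrow> real mat" where
  "multipartite_mat n c = mat n n (\<lambda>(i,j). if c i = c j then 0 else 1)"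

definition part_size :: "nat \<Rightarrow> (nat \<Rightarrow> 'c) \<Rightarrow> nat \<Rightarrow> real" where
  "part_size n c i = real (card {l. l < n \<and> c l = c i})"

text \<open>
  With $N$ the vertex-part incidence matrix and $k$ the number of parts, the adjacency matrix is
  $N (J - I) N^T$. Its Moore-Penrose inverse is $N \Delta^{-1} (J - I)^{-1} \Delta^{-1} N^T$, where
  $\Delta = N^T N$ contains the sizes of the parts and $(J - I)^{-1} = J / (k - 1) - I$.
\<close>

definition multipartite_pinv :: "nat \<Rightarrow> (nat \<Rightarrow> 'c) \<Rightarrow> real mat" where
  "multipartite_pinv n c = mat n n (\<lambda>(i,j).
     (1 / (real (card (c ` {..<n})) - 1) - (if c i = c j then 1 else 0)) / (part_size n c i * part_size n c j))"

lemma part_size_pos: "i < n \<Longrightarrow> part_size n c i > 0"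
  by (auto simp: part_size_def card_gt_0_iff)

lemma part_size_cong: "c i = c j \<Longrightarrow> part_size n c i = part_size n c j"
  by (simp add: part_size_def)

lemma sum_over_part:
  fixes f :: "nat \<Rightarrow> real"
  assumes "\<And>l. \<lbrakk>l < n; c l = c i\<rbrakk> \<Longrightarrow> f l = d"
  shows "(\<Sum>l<n. if c l = c i then f l else 0) = part_size n c i * d"
proof -
  have "(\<Sum>l<n. if c l = c i then f l else 0) = (\<Sum>l\<in>{l\<in>{..<n}. c l = c i}. f l)"
    by (rule sum.inter_filter[symmetric]) simp
  also have "\<dots> = (\<Sum>l\<in>{l\<in>{..<n}. c l = c i}. d)"
    by (intro sum.cong refl) (use assms in auto)
  finally show ?thesis by (simp add: part_size_def)
qed

lemma sum_inverse_part_size: "(\<Sum>l<n. 1 / part_size n c l) = real (card (c ` {..<n}))"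
proof -
  have "(\<Sum>l<n. 1 / part_size n c l) =
      (\<Sum>x\<in>c ` {..<n}. \<Sum>l\<in>{l\<in>{..<n}. c l = x}. 1 / part_size n c l)"
    by (rule sum.image_gen) simp
  also have "\<dots> = (\<Sum>x\<in>c ` {..<n}. 1)"
  proof (rule sum.cong[OF refl])
    fix x assume "x \<in> c ` {..<n}"
    then obtain i where i: "i < n" "x = c i" by auto
    have "(\<Sum>l\<in>{l\<in>{..<n}. c l = x}. 1 / part_size n c l) = (\<Sum>l<n. if c l = c i then 1 / part_size n c l else 0)"
      unfolding i(2) by (rule sum.inter_filter) simp
    also have "\<dots> = part_size n c i * (1 / part_size n c i)"
      by (rule sum_over_part) (metis part_size_cong)
    finally show "(\<Sum>l\<in>{l\<in>{..<n}. c l = x}. 1 / part_size n c l) = 1"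
      using part_size_pos[OF i(1), of c] by simp
  qed
  finally show ?thesis by simp
qed

text \<open>
  The matrix on the left averages over the parts; it is the orthogonal projection onto the
  vectors that are constant on parts.
\<close>

lemma averaging_mat_mult:
  fixes M :: "real mat"
  assumes M: "M \<in> carrier_mat n n"
    and const: "\<And>i l j. \<lbrakk>i < n; l < n; j < n; c l = c i\<rbrakk> \<Longrightarrow> M $$ (l,j) = M $$ (i,j)"
  shows "mat n n (\<lambda>(i,j). if c j = c i then 1 / part_size n c i else 0) * M = M"
proof (rule eq_matI)
  fix i j assume "i < dim_row M" "j < dim_col M"
  then have ij: "i < n" "j < n" using M by auto
  have "(mat n n (\<lambda>(i,j). if c j = c i then 1 / part_size n c i else 0) * M) $$ (i,j) =
      (\<Sum>l<n. if c l = c i then 1 / part_size n c i * M $$ (l,j) else 0)"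
    using ij M by (auto simp: scalar_prod_def lessThan_atLeast0 intro!: sum.cong)
  also have "\<dots> = part_size n c i * (1 / part_size n c i * M $$ (i,j))"
  proof (rule sum_over_part)
    fix l assume "l < n" "c l = c i"
    then show "1 / part_size n c i * M $$ (l,j) = 1 / part_size n c i * M $$ (i,j)"
      using const[OF ij(1) _ ij(2)] by simp
  qed
  finally show "(mat n n (\<lambda>(i,j). if c j = c i then 1 / part_size n c i else 0) * M) $$ (i,j) = M $$ (i,j)"
    using part_size_pos[OF ij(1), of c] by simp
qed (use M in auto)

text \<open>
  Both products of the two matrices equal the averaging projection, which fixes either of them
  as their columns are constant on parts.
\<close>

lemma multipartite_moore_penrose:
  assumes parts: "card (c ` {..<n}) \<ge> 2"
  shows "is_moore_penrose_inverse (multipartite_mat n c) (multipartite_pinv n c)"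
proof -
  let ?A = "multipartite_mat n c" and ?X = "multipartite_pinv n c" and ?s = "part_size n c"
  define K where "K = real (card (c ` {..<n}))"
  have K: "K \<ge> 2" using parts by (simp add: K_def)
  define Pr where "Pr = mat n n (\<lambda>(i,j). if c j = c i then 1 / ?s i else 0)"
  have A: "?A \<in> carrier_mat n n" and X: "?X \<in> carrier_mat n n"
    by (auto simp: multipartite_mat_def multipartite_pinv_def)
  have At: "transpose_mat ?A = ?A" by (rule eq_matI) (auto simp: multipartite_mat_def)
  have Xt: "transpose_mat ?X = ?X" by (rule eq_matI) (auto simp: multipartite_pinv_def mult.commute)
  have Prt: "transpose_mat Pr = Pr"
    by (rule eq_matI) (auto simp: Pr_def dest: part_size_cong)
  have X_entry: "?X $$ (i,j) = (1 / (K - 1) - (if c i = c j then 1 else 0)) / (?s i * ?s j)"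
    if "i < n" "j < n" for i j
    using that by (simp add: multipartite_pinv_def K_def)
  have AX: "?A * ?X = Pr"
  proof (rule eq_matI)
    fix i j assume "i < dim_row Pr" "j < dim_col Pr"
    then have ij: "i < n" "j < n" by (auto simp: Pr_def)
    have pos: "?s i > 0" "?s j > 0" using ij part_size_pos by auto
    \<comment> \<open>the reciprocals of the part sizes, over all vertices, sum to the number of parts\<close>
    have "(\<Sum>l<n. ?X $$ (l,j)) =
        (\<Sum>l<n. (1 / (K - 1) / ?s j) * (1 / ?s l) - (if c l = c j then 1 / (?s l * ?s j) else 0))"
      by (intro sum.cong refl) (simp add: X_entry ij diff_divide_distrib)
    also have "\<dots> = (1 / (K - 1) / ?s j) * K - ?s j * (1 / (?s j * ?s j))"
      unfolding sum_subtractf sum_distrib_left[symmetric] sum_inverse_part_size K_def[symmetric]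
      by (subst sum_over_part[where d = "1 / (?s j * ?s j)"]) (metis part_size_cong, rule refl)
    also have "\<dots> = 1 / (K - 1) / ?s j" using K pos by (simp add: field_simps)
    finally have total: "(\<Sum>l<n. ?X $$ (l,j)) = 1 / (K - 1) / ?s j" .
    have part: "(\<Sum>l<n. if c l = c i then ?X $$ (l,j) else 0) = ?s i * ?X $$ (i,j)"
    proof (rule sum_over_part)
      fix l assume l: "l < n" "c l = c i"
      then show "?X $$ (l,j) = ?X $$ (i,j)"
        using ij part_size_cong[OF l(2), of n] by (simp add: X_entry)
    qed
    have "(?A * ?X) $$ (i,j) = (\<Sum>l<n. ?X $$ (l,j) - (if c l = c i then ?X $$ (l,j) else 0))"
      using ij X by (auto simp: multipartite_mat_def scalar_prod_def lessThan_atLeast0 intro!: sum.cong)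
    also have "\<dots> = 1 / (K - 1) / ?s j - ?s i * ?X $$ (i,j)"
      by (simp only: sum_subtractf total part)
    also have "\<dots> = (if c j = c i then 1 / ?s j else 0)"
    proof -
      have "?s i * ?X $$ (i,j) = (1 / (K - 1) - (if c i = c j then 1 else 0)) / ?s j"
        using pos by (simp add: X_entry[OF ij])
      then show ?thesis by (simp add: diff_divide_distrib)
    qed
    also have "\<dots> = Pr $$ (i,j)" using ij part_size_cong[of c i j n] by (auto simp: Pr_def)
    finally show "(?A * ?X) $$ (i,j) = Pr $$ (i,j)" .
  qed (use A X in \<open>auto simp: Pr_def\<close>)
  have XA: "?X * ?A = Pr"
    using arg_cong[OF AX, of transpose_mat] transpose_mult[OF A X] by (simp add: At Xt Prt)
  have "Pr * ?A = ?A" unfolding Pr_def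
    by (rule averaging_mat_mult[OF A]) (auto simp: multipartite_mat_def)
  moreover have "Pr * ?X = ?X" unfolding Pr_def
  proof (rule averaging_mat_mult[OF X])
    fix i l j assume l: "i < n" "l < n" "j < n" "c l = c i"
    then show "?X $$ (l,j) = ?X $$ (i,j)"
      using part_size_cong[OF l(4), of n] by (simp add: X_entry)
  qed
  ultimately show ?thesis
    using A X AX XA Prt by (simp add: is_moore_penrose_inverse_def carrier_matD[OF A])
qed

lemma pseudo_inverse_multipartite:
  assumes "card (c ` {..<n}) \<ge> 2"
  shows "pseudo_inverse (multipartite_mat n c) = multipartite_pinv n c"
  unfolding pseudo_inverse_def
  using multipartite_moore_penrose[OF assms] is_moore_penrose_inverse_unique by blast

lemma signature_conjugate_entry:
  assumes D: "is_signature_matrix n D" and B: "B \<in> carrier_mat n n" and ij: "i < n" "j < n"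
  shows "(D * B * D) $$ (i,j) = D $$ (i,i) * B $$ (i,j) * D $$ (j,j)"
proof -
  have D': "D \<in> carrier_mat n n" and D0: "\<And>i j. \<lbrakk>i < n; j < n; i \<noteq> j\<rbrakk> \<Longrightarrow> D $$ (i,j) = 0"
    using D by (auto simp: is_signature_matrix_def diagonal_mat_def)
  have DB: "(D * B) $$ (i,l) = D $$ (i,i) * B $$ (i,l)" if l: "l < n" for l
  proof -
    have "(D * B) $$ (i,l) = (\<Sum>k<n. D $$ (i,k) * B $$ (k,l))"
      using D' B ij l by (simp add: scalar_prod_def lessThan_atLeast0)
    also have "\<dots> = (\<Sum>k<n. if k = i then D $$ (i,i) * B $$ (i,l) else 0)"
      by (intro sum.cong refl) (use D0 ij in auto)
    finally show ?thesis using ij by simp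
  qed
  define M where "M = D * B"
  have M: "M \<in> carrier_mat n n" using D' B by (simp add: M_def)
  have "(M * D) $$ (i,j) = (\<Sum>l<n. M $$ (i,l) * D $$ (l,j))"
    using M D' ij by (simp add: scalar_prod_def lessThan_atLeast0)
  also have "\<dots> = (\<Sum>l<n. if l = j then M $$ (i,j) * D $$ (j,j) else 0)"
    by (intro sum.cong refl) (use D0 ij in auto)
  finally show ?thesis using ij DB by (simp add: M_def)
qed

text \<open>
  With three or more parts the pseudo-inverse has negative diagonal entries, which conjugation with a
  signature does not change, and positive entries between different parts. Three vertices from
  different parts would need three pairwise different signs to make the latter negative.
\<close>

lemma three_parts_not_signable:
  assumes parts: "card (c ` {..<n}) \<ge> 3"
  shows "\<not> signable_pseudo_invertible (multipartite_mat n c)"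
proof -
  let ?X = "multipartite_pinv n c"
  have X: "?X \<in> carrier_mat n n" by (simp add: multipartite_pinv_def)
  obtain T where "T \<subseteq> c ` {..<n}" "card T = 3" using parts obtain_subset_with_card_n by metis
  then obtain u v w where uvw: "u < n" "v < n" "w < n" "c u \<noteq> c v" "c v \<noteq> c w" "c u \<noteq> c w"
    by (auto simp: card_3_iff)
  have diag: "?X $$ (i,i) < 0" if "i < n" for i
    using that parts part_size_pos[OF that, of c]
    by (auto simp: multipartite_pinv_def field_simps intro!: divide_neg_pos)
  have off: "?X $$ (i,j) > 0" if "i < n" "j < n" "c i \<noteq> c j" for i j
    using that parts part_size_pos[of i n c] part_size_pos[of j n c] by (simp add: multipartite_pinv_def)
  have sq: "D $$ (i,i) = 1 \<or> D $$ (i,i) = -1" if "is_signature_matrix n D" "i < n" for D i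
    using that by (auto simp: is_signature_matrix_def)
  have "\<not> positively_signable ?X"
  proof
    assume "positively_signable ?X"
    then obtain D where D: "is_signature_matrix n D" and "(D * ?X * D) $$ (u,u) \<ge> 0"
      using X uvw(1) by (auto simp: positively_signable_def)
    then show False
      using signature_conjugate_entry[OF D X uvw(1,1)] sq[OF D uvw(1)] diag[OF uvw(1)] by auto
  qed
  moreover have "\<not> negatively_signable ?X"
  proof
    assume "negatively_signable ?X"
    then obtain D where D: "is_signature_matrix n D"
      and neg: "\<And>i j. \<lbrakk>i < n; j < n\<rbrakk> \<Longrightarrow> (D * ?X * D) $$ (i,j) \<le> 0"
      using X by (auto simp: negatively_signable_def)
    have ne: "D $$ (i,i) \<noteq> D $$ (j,j)" if "i < n" "j < n" "c i \<noteq> c j" for i j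
      using signature_conjugate_entry[OF D X that(1,2)] neg[OF that(1,2)] off[OF that] sq[OF D that(1)]
      by force
    show False
      using ne[OF uvw(1,2,4)] ne[OF uvw(2,3,5)] ne[OF uvw(1,3,6)] sq[OF D uvw(1)] sq[OF D uvw(2)] sq[OF D uvw(3)]
      by auto
  qed
  moreover have "pseudo_inverse (multipartite_mat n c) = ?X"
    by (rule pseudo_inverse_multipartite) (use parts in simp)
  ultimately show ?thesis by (simp add: signable_pseudo_invertible_def)
qed

lemma two_parts_signable:
  assumes parts: "card (c ` {..<n}) = 2"
  shows "signable_pseudo_invertible (multipartite_mat n c)"
proof -
  let ?X = "multipartite_pinv n c"
  have "positively_signable ?X"
    unfolding positively_signable_def
  proof (intro exI conjI allI impI)
    show "is_signature_matrix (dim_row ?X) (1\<^sub>m n)"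
      by (auto simp: is_signature_matrix_def diagonal_mat_def multipartite_pinv_def)
    fix i j assume "i < dim_row ?X" "j < dim_col ?X"
    then have ij: "i < n" "j < n" by (auto simp: multipartite_pinv_def)
    have "?X \<in> carrier_mat n n" by (simp add: multipartite_pinv_def)
    then have "1\<^sub>m n * ?X * 1\<^sub>m n = ?X" by simp
    then show "(1\<^sub>m n * ?X * 1\<^sub>m n) $$ (i,j) \<ge> 0"
      using ij parts by (simp add: multipartite_pinv_def part_size_def)
  qed
  moreover have "pseudo_inverse (multipartite_mat n c) = ?X"
    by (rule pseudo_inverse_multipartite) (use parts in simp)
  ultimately show ?thesis by (simp add: signable_pseudo_invertible_def)
qed

section \<open>Spectral indices of connected graphs\<close>

text \<open>
  Every vertex other than the root has a neighbour that is closer to the root. The resulting tree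
  edges are counted once for each orientation; no arc is counted twice since the distance to the
  root decreases along the edge to the parent.
\<close>

lemma two_card_vertices_le_card_arcs:
  assumes fin: "finite V" and E: "E \<subseteq> V \<times> V" and sym: "sym E" and r: "r \<in> V"
    and reach: "\<And>v. v \<in> V \<Longrightarrow> (r,v) \<in> E\<^sup>*"
  shows "2 * (card V - 1) \<le> card E"
proof -
  define d where "d v = (LEAST t. (r,v) \<in> E ^^ t)" for v
  have d: "(r,v) \<in> E ^^ d v" if v: "v \<in> V" for v
  proof -
    obtain t where "(r,v) \<in> E ^^ t" using reach[OF v] rtrancl_imp_relpow by metis
    then show ?thesis unfolding d_def by (rule LeastI)
  qed
  have "\<exists>w. (w,v) \<in> E \<and> d w < d v" if v: "v \<in> V - {r}" for v
  proof (cases "d v")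
    case 0
    then show ?thesis using d[of v] v by auto
  next
    case (Suc t)
    then obtain w where w: "(r,w) \<in> E ^^ t" "(w,v) \<in> E" using d[of v] v by auto
    then have "d w \<le> t" unfolding d_def by (intro Least_le)
    then show ?thesis using w Suc by auto
  qed
  then obtain par where par: "\<And>v. v \<in> V - {r} \<Longrightarrow> (par v,v) \<in> E \<and> d (par v) < d v" by metis
  \<comment> \<open>the arcs from a parent to its child, and their reversals\<close>
  let ?down = "(\<lambda>v. (par v,v)) ` (V - {r})" and ?up = "(\<lambda>v. (v,par v)) ` (V - {r})"
  have "?down \<union> ?up \<subseteq> E" using par sym by (auto dest: symD)
  moreover have "finite E" using fin E finite_subset by blast
  ultimately have "card (?down \<union> ?up) \<le> card E" by (intro card_mono)
  moreover have "?down \<inter> ?up = {}" using par by (auto, metis DiffI less_asym singletonD)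
  then have "card (?down \<union> ?up) = card ?down + card ?up"
    by (intro card_Un_disjoint) (use fin in auto)
  moreover have "card ?down = card V - 1" "card ?up = card V - 1"
    using r fin by (simp_all add: card_image inj_on_def card_Diff_singleton)
  ultimately show ?thesis by simp
qed

text \<open>
  Two positive eigenvalues suffice for the bound. Otherwise non-adjacency is an equivalence
  relation, so the graph is complete multipartite; signability leaves only two parts, and the least
  positive eigenvalue is then the square root of the product of their sizes.
\<close>

lemma (in orthonormal_eigenbasis) signable_least_pos_eigenvalue_le:
  assumes entries: "\<And>i j. \<lbrakk>i < n; j < n\<rbrakk> \<Longrightarrow> A $$ (i,j) = (if R i j then 1 else 0)"
    and sym: "\<And>i j. R i j \<Longrightarrow> R j i" and irrefl: "\<And>i. \<not> R i i"
    and n: "n \<noteq> 0" and neighbour: "\<And>v. v < n \<Longrightarrow> \<exists>x<n. R v x"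
    and signable: "signable_pseudo_invertible A"
  shows "least_pos_eigenvalue A \<le> sqrt (balanced_product n)"
proof -
  obtain x0 where x0: "x0 < n" "R 0 x0" using neighbour[of 0] n by auto
  have tr: "(\<Sum>i<n. A $$ (i,i)) = 0" using irrefl by (simp add: entries)
  have nz: "\<exists>i<n. \<exists>j<n. A $$ (i,j) \<noteq> 0" using x0 n entries[of 0 x0] by (metis gr0I zero_neq_one)
  note least = least_pos_eigenvalue[OF positive_and_negative_eigenvalue(1)[OF tr nz]]
  show ?thesis
  proof (cases "\<exists>k<n. \<exists>l<n. k \<noteq> l \<and> b k > 0 \<and> b l > 0")
    case True
    then obtain k l where kl: "k < n" "l < n" "k \<noteq> l" "b k > 0" "b l > 0" by blast
    show ?thesis
      by (rule two_eigenvalues_ge_imp_le_balanced[OF _ kl(1-3) least(3)[OF kl(1,4)] least(3)[OF kl(2,5)]])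
        (simp add: entries)
  next
    case False
    have trans: "\<not> R u w" if uvw: "u < n" "v < n" "w < n" and "\<not> R u v" "\<not> R v w" for u v w
    proof
      assume "R u w"
      obtain x where "x < n" "R v x" using neighbour uvw(2) by blast
      obtain k l where "k < n" "l < n" "k \<noteq> l" "b k > 0" "b l > 0"
        by (rule missing_transitivity_imp_two_positive_eigenvalues[where R = R,
              OF entries sym irrefl uvw \<open>x < n\<close> \<open>\<not> R u v\<close> \<open>\<not> R v w\<close> \<open>R u w\<close> \<open>R v x\<close>])
      then show False using False by blast
    qed
    \<comment> \<open>the part that contains \<open>i\<close> is the set of its non-neighbours\<close>
    define c where "c i = {j. j < n \<and> \<not> R i j}" for i
    have c: "R i j \<longleftrightarrow> c i \<noteq> c j" if ij: "i < n" "j < n" for i j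
    proof
      assume "R i j"
      then have "i \<in> c i" "i \<notin> c j" using ij irrefl sym by (auto simp: c_def)
      then show "c i \<noteq> c j" by blast
    next
      assume "c i \<noteq> c j"
      show "R i j"
      proof (rule ccontr)
        assume "\<not> R i j"
        then have "R i l \<longleftrightarrow> R j l" if "l < n" for l
          using trans[of i j l] trans[of j i l] ij that sym[of i j] sym[of j i] by blast
        then have "c i = c j" unfolding c_def by blast
        with \<open>c i \<noteq> c j\<close> show False by simp
      qed
    qed
    have A_eq: "A = multipartite_mat n c"
    proof (rule eq_matI)
      fix i j assume "i < dim_row (multipartite_mat n c)" "j < dim_col (multipartite_mat n c)"
      then have "i < n" "j < n" by (auto simp: multipartite_mat_def)
      then show "A $$ (i,j) = multipartite_mat n c $$ (i,j)"
        using c[of i j] by (simp add: entries multipartite_mat_def)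
    qed (use A in \<open>auto simp: multipartite_mat_def\<close>)
    have ne: "c 0 \<noteq> c x0" using c[of 0 x0] x0 n by simp
    have sub: "{c 0, c x0} \<subseteq> c ` {..<n}" using x0 n by auto
    then have "card (c ` {..<n}) \<ge> 2" using card_mono[OF _ sub] ne by simp
    moreover have "\<not> card (c ` {..<n}) \<ge> 3"
      using three_parts_not_signable[of c n] signable A_eq by auto
    ultimately have two: "card (c ` {..<n}) = 2" by linarith
    have img: "c ` {..<n} = {c 0, c x0}"
      by (rule card_subset_eq[symmetric]) (use sub two ne in auto)
    define U where "U = {i. i < n \<and> c i = c 0}"
    have entries': "A $$ (i,j) = (if (i \<in> U) \<noteq> (j \<in> U) then 1 else 0)" if ij: "i < n" "j < n" for i j
    proof -
      have "c i \<in> {c 0, c x0}" "c j \<in> {c 0, c x0}" using ij unfolding img[symmetric] by auto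
      then show ?thesis using ij c[OF ij] ne by (auto simp: entries U_def)
    qed
    have "0 \<in> U" "x0 \<notin> U" "x0 \<in> {..<n}" using n x0 ne by (simp_all add: U_def)
    then have "U \<noteq> {}" "U \<noteq> {..<n}" by blast+
    moreover have "U \<subseteq> {..<n}" by (auto simp: U_def)
    ultimately have U: "U \<subseteq> {..<n}" "U \<noteq> {}" "U \<noteq> {..<n}" by blast+
    have "card U + (n - card U) = n" using card_mono[OF _ U(1)] by simp
    then have "sqrt (real (card U) * real (n - card U)) \<le> sqrt (balanced_product n)"
      by (intro real_sqrt_le_mono product_le_balanced_product)
    moreover have "least_pos_eigenvalue A = sqrt (real (card U) * real (n - card U))"
      by (rule complete_bipartite_eigenvalues(1)[OF entries' U])
    ultimately show ?thesis by simp
  qed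
qed

lemma adjacency_matrix_orthonormal_eigenbasis:
  assumes G: "graph G" and adj: "is_adjacency_matrix A G"
  obtains vs b p where "distinct vs" "set vs = verts G" "length vs = card (verts G)"
    "\<And>i j. \<lbrakk>i < length vs; j < length vs\<rbrakk> \<Longrightarrow> A $$ (i,j) = (if (vs ! i, vs ! j) \<in> arcs_ends G then 1 else 0)"
    "orthonormal_eigenbasis A (length vs) b p"
proof -
  interpret graph G by fact
  obtain vs where vs: "distinct vs" "set vs = verts G"
    and A: "A = mat (length vs) (length vs) (\<lambda>(i, j). if (vs ! i, vs ! j) \<in> arcs_ends G then 1 else 0)"
    using adj by (auto simp: is_adjacency_matrix_def)
  have "transpose_mat A = A"
    unfolding A by (rule eq_matI) (use arcs_ends_symmetric[OF sym_arcs] in auto)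
  moreover have "A \<in> carrier_mat (length vs) (length vs)" by (simp add: A)
  ultimately obtain b p where "orthonormal_eigenbasis A (length vs) b p"
    using orthonormal_eigenbasis_exists by blast
  then show thesis using that[of vs b p] vs A distinct_card[of vs] by simp
qed

lemma connected_graph_rtrancl:
  assumes "graph G" "Digraph_Component.connected G" "u \<in> verts G" "v \<in> verts G"
  shows "(u,v) \<in> (arcs_ends G)\<^sup>*"
proof -
  interpret graph G by fact
  have "strongly_connected G" using symmetric_connected_imp_strongly_connected sym_arcs assms(2) by blast
  then show ?thesis using assms(3,4) reachable_rtranclI by (metis strongly_connectedE)
qed

theorem signable_graph_spectral_bounds:
  assumes G: "graph G" and conn: "Digraph_Component.connected G" and m: "card (verts G) = m" "m \<ge> 2"
    and adj: "is_adjacency_matrix A G" and signable: "signable_pseudo_invertible A"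
  shows "0 < least_pos_eigenvalue A" "least_pos_eigenvalue A \<le> sqrt (balanced_product m)"
    and "greatest_neg_eigenvalue A < 0" "- sqrt (balanced_product m) \<le> greatest_neg_eigenvalue A"
    and "spectral_pow A \<ge> 2 * sqrt (real m - 1)"
proof -
  interpret graph G by fact
  obtain vs b p where vs: "distinct vs" "set vs = verts G" "length vs = m"
    and entries: "\<And>i j. \<lbrakk>i < m; j < m\<rbrakk> \<Longrightarrow> A $$ (i,j) = (if (vs ! i, vs ! j) \<in> arcs_ends G then 1 else 0)"
    and basis: "orthonormal_eigenbasis A m b p"
    using adjacency_matrix_orthonormal_eigenbasis[OF G adj] m(1) by metis
  interpret orthonormal_eigenbasis A m b p by fact
  define R where "R i j \<longleftrightarrow> (vs ! i, vs ! j) \<in> arcs_ends G" for i j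
  have R: "A $$ (i,j) = (if R i j then 1 else 0)" if "i < m" "j < m" for i j
    using entries[OF that] by (simp add: R_def)
  have symR: "R i j \<Longrightarrow> R j i" for i j
    using arcs_ends_symmetric[OF sym_arcs] by (simp add: R_def)
  have irreflR: "\<not> R i i" for i using adj_not_same by (auto simp: R_def)
  have mem: "vs ! i \<in> verts G" if "i < m" for i using that vs(2,3) nth_mem by metis
  have neighbour: "\<exists>j<m. R i j" if i: "i < m" for i
  proof -
    \<comment> \<open>a path to some other vertex starts with an edge\<close>
    obtain j where j: "j < m" "j \<noteq> i"
      using m(2) by (intro that[of "if i = 0 then 1 else 0"]) auto
    then have ne: "vs ! i \<noteq> vs ! j" using vs i by (simp add: nth_eq_iff_index_eq)
    have "(vs ! i, vs ! j) \<in> (arcs_ends G)\<^sup>*"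
      by (rule connected_graph_rtrancl[OF G conn mem[OF i] mem[OF j(1)]])
    then obtain w where "(vs ! i, w) \<in> arcs_ends G" using ne by (meson converse_rtranclE)
    moreover from this have "w \<in> set vs" using adj_in_verts vs by blast
    then obtain j' where "j' < m" "vs ! j' = w" using vs(3) by (metis in_set_conv_nth)
    ultimately show ?thesis unfolding R_def by blast
  qed
  obtain j where j: "j < m" "R 0 j" using neighbour[of 0] m by auto
  have tr: "(\<Sum>i<m. A $$ (i,i)) = 0" using irreflR by (simp add: R)
  have nz: "\<exists>i<m. \<exists>j<m. A $$ (i,j) \<noteq> 0" using j m R[of 0 j] by (intro exI[of _ 0] conjI exI[of _ j]) auto
  note ex = positive_and_negative_eigenvalue[OF tr nz]
  show "0 < least_pos_eigenvalue A" by (rule least_pos_eigenvalue(1)[OF ex(1)])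
  show "least_pos_eigenvalue A \<le> sqrt (balanced_product m)"
    by (rule signable_least_pos_eigenvalue_le[where R = R, OF R symR irreflR _ neighbour signable]) (use m in auto)
  show "greatest_neg_eigenvalue A < 0" by (rule greatest_neg_eigenvalue(1)[OF ex(2)])
  have "- sqrt (balanced_product m) \<le> b k" if "k < m" for k
    by (rule eigenvalue_ge_balanced[OF _ that]) (simp add: R)
  then show "- sqrt (balanced_product m) \<le> greatest_neg_eigenvalue A"
    using greatest_neg_eigenvalue(2)[OF ex(2)] by metis
  have "(\<Sum>i<m. \<Sum>j<m. (A $$ (i,j))\<^sup>2) =
      (\<Sum>i<m. \<Sum>j<m. if (vs ! i, vs ! j) \<in> arcs_ends G then 1 else 0)"
    by (intro sum.cong refl) (simp add: entries)
  also have "\<dots> = (\<Sum>u\<in>verts G. \<Sum>v\<in>verts G. if (u,v) \<in> arcs_ends G then 1 else 0)"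
  proof -
    have bij: "bij_betw ((!) vs) {..<m} (verts G)" using vs by (intro bij_betw_nth) auto
    show ?thesis
      unfolding sum.reindex_bij_betw[OF bij, symmetric] by simp
  qed
  also have "\<dots> = (\<Sum>e\<in>verts G \<times> verts G. if e \<in> arcs_ends G then 1 else 0)"
    by (simp add: sum.cartesian_product case_prod_beta)
  also have "\<dots> = real (card (arcs_ends G))"
  proof -
    have sub: "arcs_ends G \<subseteq> verts G \<times> verts G" using adj_in_verts by auto
    have "(\<Sum>e\<in>verts G \<times> verts G. if e \<in> arcs_ends G then 1 else 0) =
        (\<Sum>e\<in>(verts G \<times> verts G) \<inter> arcs_ends G. 1 :: real)"
      by (rule sum.inter_restrict[symmetric]) simp
    then show ?thesis using sub by (simp add: Int_absorb1)
  qed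
  finally have sum_sq: "(\<Sum>i<m. \<Sum>j<m. (A $$ (i,j))\<^sup>2) = real (card (arcs_ends G))" .
  have r: "vs ! 0 \<in> verts G" using mem m by simp
  have "2 * (card (verts G) - 1) \<le> card (arcs_ends G)"
  proof (rule two_card_vertices_le_card_arcs[OF _ _ _ r])
    show "arcs_ends G \<subseteq> verts G \<times> verts G" using adj_in_verts by auto
    show "sym (arcs_ends G)" using sym_arcs by (simp add: symmetric_def)
  qed (simp_all add: connected_graph_rtrancl[OF G conn r])
  then have "2 * m \<le> card (arcs_ends G) + 2" using m by linarith
  then have "real (2 * m) \<le> real (card (arcs_ends G) + 2)" by (simp only: of_nat_le_iff)
  then have "2 * (real m - 1) \<le> real (card (arcs_ends G))" by simp
  have "2 * sqrt (real m - 1) = sqrt (4 * (real m - 1))"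
    using real_sqrt_mult[of 4 "real m - 1"] by (simp only: real_sqrt_four)
  also have "\<dots> \<le> sqrt (2 * real (card (arcs_ends G)))"
    using \<open>2 * (real m - 1) \<le> real (card (arcs_ends G))\<close> by (intro real_sqrt_le_mono) linarith
  also have "\<dots> \<le> spectral_pow A" using spectral_pow_ge[OF tr] by (simp add: sum_sq)
  finally show "spectral_pow A \<ge> 2 * sqrt (real m - 1)" .
qed

section \<open>Complete bipartite graphs\<close>

lemma complete_bipartite_exists:
  "\<exists>K :: (nat, nat \<times> nat) pre_digraph. complete_bipartite_digraph p q K"
proof -
  let ?U = "{..<p}" and ?V = "{p..<p+q}"
  have "complete_bipartite_digraph p q (with_proj \<lparr>pverts = ?U \<union> ?V, parcs = ?U \<times> ?V \<union> ?V \<times> ?U\<rparr>)"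
    unfolding complete_bipartite_digraph_pair_def
    by (intro conjI exI[of _ ?U] exI[of _ ?V]) auto
  then show ?thesis by blast
qed

lemma complete_bipartite_graph:
  assumes K: "complete_bipartite_digraph p q K" and pq: "p > 0" "q > 0"
  shows "graph K" "Digraph_Component.connected K" "card (verts K) = p + q"
proof -
  show "graph K" using K by (simp add: complete_bipartite_digraph_def)
  interpret graph K by fact
  obtain U V where UV: "verts K = U \<union> V" "U \<inter> V = {}" "card U = p" "card V = q"
    and E: "arcs_ends K = U \<times> V \<union> V \<times> U"
    using K by (auto simp: complete_bipartite_digraph_def)
  obtain u0 v0 where uv0: "u0 \<in> U" "v0 \<in> V" using UV pq by (metis card.empty ex_in_conv less_irrefl)
  have "finite U" "finite V" using finite_verts UV(1) by auto
  then show "card (verts K) = p + q" using UV by (simp add: card_Un_disjoint)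
  have "u \<rightarrow>\<^sup>*\<^bsub>K\<^esub> v" if "u \<in> verts K" "v \<in> verts K" for u v
  proof -
    define w where "w = (if u \<in> U then v0 else u0)"
    have "(u,v) \<in> arcs_ends K \<or> (u,w) \<in> arcs_ends K \<and> (w,v) \<in> arcs_ends K"
      using that uv0 unfolding UV(1) E w_def by auto
    then show ?thesis by (meson adj_reachable_trans reachable_adjI)
  qed
  then have "strongly_connected K" using uv0 UV(1) by (auto simp: strongly_connected_def)
  then show "Digraph_Component.connected K"
    unfolding connected_def strongly_connected_def
    using reachable_mk_symmetric_eq[OF sym_arcs] by simp
qed

theorem complete_bipartite_spectrum:
  assumes K: "complete_bipartite_digraph p q K" and pq: "p > 0" "q > 0"
    and adj: "is_adjacency_matrix B K"
  shows "signable_pseudo_invertible B"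
    and "least_pos_eigenvalue B = sqrt (real p * real q)"
    and "greatest_neg_eigenvalue B = - sqrt (real p * real q)"
    and "spectral_pow B = 2 * sqrt (real p * real q)"
proof -
  note G = complete_bipartite_graph[OF K pq]
  interpret graph K by (rule G(1))
  obtain U V where UV: "verts K = U \<union> V" "U \<inter> V = {}" "card U = p" "card V = q"
    and E: "arcs_ends K = U \<times> V \<union> V \<times> U"
    using K by (auto simp: complete_bipartite_digraph_def)
  obtain u0 v0 where uv0: "u0 \<in> U" "v0 \<in> V" using UV pq by (metis card.empty ex_in_conv less_irrefl)
  obtain vs b P where vs: "distinct vs" "set vs = verts K" "length vs = p + q"
    and entries: "\<And>i j. \<lbrakk>i < p + q; j < p + q\<rbrakk> \<Longrightarrow> B $$ (i,j) = (if (vs ! i, vs ! j) \<in> arcs_ends K then 1 else 0)"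
    and basis: "orthonormal_eigenbasis B (p + q) b P"
    using adjacency_matrix_orthonormal_eigenbasis[OF G(1) adj] G(3) by metis
  interpret orthonormal_eigenbasis B "p + q" b P by fact
  have inUV: "vs ! i \<in> U \<union> V" if "i < p + q" for i using vs that UV(1) by (metis nth_mem)
  define c where "c i \<longleftrightarrow> vs ! i \<in> U" for i
  have c: "B $$ (i,j) = (if c i = c j then 0 else 1)" if ij: "i < p + q" "j < p + q" for i j
    using inUV[OF ij(1)] inUV[OF ij(2)] UV(2) by (auto simp: entries[OF ij] E c_def)
  have "B = multipartite_mat (p + q) c"
    by (rule eq_matI) (use A c in \<open>auto simp: multipartite_mat_def\<close>)
  moreover obtain i0 j0 where ij0: "i0 < p + q" "vs ! i0 = u0" "j0 < p + q" "vs ! j0 = v0"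
    using uv0 vs UV(1) by (metis UnCI in_set_conv_nth)
  then have "c i0" "\<not> c j0" using uv0 UV(2) by (auto simp: c_def)
  then have "c ` {..<p + q} = UNIV" using ij0 unfolding UNIV_bool by (auto intro: rev_image_eqI)
  then have "card (c ` {..<p + q}) = 2" by simp
  ultimately show "signable_pseudo_invertible B" using two_parts_signable by metis
  define U' where "U' = {i. i < p + q \<and> c i}"
  have U': "U' \<subseteq> {..<p + q}" "U' \<noteq> {}" "U' \<noteq> {..<p + q}"
    using ij0 \<open>c i0\<close> \<open>\<not> c j0\<close> by (auto simp: U'_def)
  have e: "B $$ (i,j) = (if (i \<in> U') \<noteq> (j \<in> U') then 1 else 0)" if "i < p + q" "j < p + q" for i j
    using c[OF that] that by (auto simp: U'_def)
  have "(!) vs ` U' = U"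
    using vs UV(1) by (auto simp: U'_def c_def in_set_conv_nth) (metis (mono_tags, lifting) UnI1 imageI in_set_conv_nth mem_Collect_eq)
  moreover have "inj_on ((!) vs) U'" using vs by (auto simp: U'_def inj_on_def nth_eq_iff_index_eq)
  ultimately have "card U' = p" using UV(3) card_image by metis
  note spec = complete_bipartite_eigenvalues[OF e U', unfolded this]
  show "least_pos_eigenvalue B = sqrt (real p * real q)"
    "greatest_neg_eigenvalue B = - sqrt (real p * real q)"
    "spectral_pow B = 2 * sqrt (real p * real q)"
    using spec by simp_all
qed

section \<open>Extremal spectral indices\<close>

theorem proposition3p1:
  fixes m :: nat
  assumes "m \<ge> 2"
  shows
    "(\<forall>(G :: ('a, 'b) pre_digraph) A.
        graph G \<and> Digraph_Component.connected G \<and> card (verts G) = m \<and>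
        is_adjacency_matrix A G \<and> signable_pseudo_invertible A \<longrightarrow>
          spectral_gap A \<le> 2 * sqrt (of_int (\<lfloor>real m / 2\<rfloor> * \<lceil>real m / 2\<rceil>)) \<and>
          spectral_ind A \<le> sqrt (of_int (\<lfloor>real m / 2\<rfloor> * \<lceil>real m / 2\<rceil>)) \<and>
          spectral_pow A \<ge> 2 * sqrt (real m - 1)) \<and>
     (\<exists>K :: (nat, nat \<times> nat) pre_digraph.
        complete_bipartite_digraph (nat \<lceil>real m / 2\<rceil>) (nat \<lfloor>real m / 2\<rfloor>) K) \<and>
     (\<forall>(K :: ('c, 'd) pre_digraph) B.
        complete_bipartite_digraph (nat \<lceil>real m / 2\<rceil>) (nat \<lfloor>real m / 2\<rfloor>) K \<and>
        is_adjacency_matrix B K \<longrightarrow>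
          graph K \<and> Digraph_Component.connected K \<and> card (verts K) = m \<and>
          signable_pseudo_invertible B \<and>
          spectral_gap B = 2 * sqrt (of_int (\<lfloor>real m / 2\<rfloor> * \<lceil>real m / 2\<rceil>)) \<and>
          spectral_ind B = sqrt (of_int (\<lfloor>real m / 2\<rfloor> * \<lceil>real m / 2\<rceil>))) \<and>
     (\<exists>S :: (nat, nat \<times> nat) pre_digraph. complete_bipartite_digraph (m - 1) 1 S) \<and>
     (\<forall>(S :: ('c, 'd) pre_digraph) B.
        complete_bipartite_digraph (m - 1) 1 S \<and> is_adjacency_matrix B S \<longrightarrow>
          graph S \<and> Digraph_Component.connected S \<and> card (verts S) = m \<and>
          signable_pseudo_invertible B \<and>
          spectral_pow B = 2 * sqrt (real m - 1))"
proof (intro conjI allI impI complete_bipartite_exists; (elim conjE)?)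
  fix G :: "('a, 'b) pre_digraph" and A
  assume G: "graph G" "Digraph_Component.connected G" "card (verts G) = m"
    "is_adjacency_matrix A G" "signable_pseudo_invertible A"
  note bounds = signable_graph_spectral_bounds[OF G(1-3) assms G(4,5), unfolded balanced_product_def]
  show "spectral_gap A \<le> 2 * sqrt (of_int (\<lfloor>real m / 2\<rfloor> * \<lceil>real m / 2\<rceil>))"
    using bounds(2,4) unfolding spectral_gap_def by linarith
  show "spectral_ind A \<le> sqrt (of_int (\<lfloor>real m / 2\<rfloor> * \<lceil>real m / 2\<rceil>))"
    using bounds(1-4) unfolding spectral_ind_def by linarith
  show "spectral_pow A \<ge> 2 * sqrt (real m - 1)" by (rule bounds(5))
next
  fix K :: "('c, 'd) pre_digraph" and B
  assume K: "complete_bipartite_digraph (nat \<lceil>real m / 2\<rceil>) (nat \<lfloor>real m / 2\<rfloor>) K"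
    and adj: "is_adjacency_matrix B K"
  have pos: "nat \<lceil>real m / 2\<rceil> > 0" "nat \<lfloor>real m / 2\<rfloor> > 0"
    using assms by (auto simp: floor_ceiling_half)
  have prod: "real (nat \<lceil>real m / 2\<rceil>) * real (nat \<lfloor>real m / 2\<rfloor>) = of_int (\<lfloor>real m / 2\<rfloor> * \<lceil>real m / 2\<rceil>)"
    by (simp add: floor_ceiling_half mult.commute)
  have sum: "nat \<lceil>real m / 2\<rceil> + nat \<lfloor>real m / 2\<rfloor> = m"
    by (simp add: floor_ceiling_half)
  note graph = complete_bipartite_graph[OF K pos, unfolded sum]
  note spec = complete_bipartite_spectrum[OF K pos adj, unfolded prod]
  show "graph K" "Digraph_Component.connected K" "card (verts K) = m" by (rule graph)+
  show "signable_pseudo_invertible B" by (rule spec)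
  show "spectral_gap B = 2 * sqrt (of_int (\<lfloor>real m / 2\<rfloor> * \<lceil>real m / 2\<rceil>))"
    by (simp add: spectral_gap_def spec)
  have "sqrt (of_int (\<lfloor>real m / 2\<rfloor> * \<lceil>real m / 2\<rceil>)) \<ge> 0"
    unfolding prod[symmetric] by simp
  then show "spectral_ind B = sqrt (of_int (\<lfloor>real m / 2\<rfloor> * \<lceil>real m / 2\<rceil>))"
    by (simp only: spectral_ind_def spec abs_minus_cancel abs_of_nonneg max.idem)
next
  fix S :: "('c, 'd) pre_digraph" and B
  assume S: "complete_bipartite_digraph (m - 1) 1 S" and adj: "is_adjacency_matrix B S"
  have pos: "m - 1 > 0" "(1::nat) > 0" using assms by auto
  have sum: "m - 1 + 1 = m" using assms by simp
  note graph = complete_bipartite_graph[OF S pos, unfolded sum]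
  note spec = complete_bipartite_spectrum[OF S pos adj]
  show "graph S" "Digraph_Component.connected S" "card (verts S) = m" by (rule graph)+
  show "signable_pseudo_invertible B" by (rule spec)
  show "spectral_pow B = 2 * sqrt (real m - 1)" using spec(4) assms by (simp add: of_nat_diff)
qed

end
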